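(* Let $\rho_3=2\sqrt[3]{4}$. If $H$ is a connected $3$-uniform hypergraph with $\rho(H)<\rho_3$, then $H$ is isomorphic to one of the following hypergraphs: (1) $A^{(3)}_n$ for some $n\geq 1$; (2) $D^{(3)}_n$ for some $n\geq 3$; (3) ${D'}^{(3)}_n$ for some $n\geq 4$; (4) $B^{(3)}_n$ for some $n\geq 5$; (5) ${B'}^{(3)}_n$ for some $n\geq 6$; (6) $\bar B^{(3)}_n$ for some $n\geq 7$; (7) $BD^{(3)}_n$ for some $n\geq 5$; (8) one of the thirty-one exceptional hypergraphs $E^{(3)}_6$, $E^{(3)}_7$, $E^{(3)}_8$, $F^{(3)}_{2,3,3}$, $F^{(3)}_{2,2,k}$ ($2\leq k\leq 6$), $F^{(3)}_{1,3,k}$ ($3\leq k\leq 13$), $F^{(3)}_{1,4,k}$ ($4\leq k\leq 7$), $F^{(3)}_{1,5,5}$, $G^{(3)}_{1,1:k:1,3}$ ($0\leq k\leq 5$).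
   Context: An $r$-uniform hypergraph $H=(V,E)$ has a finite vertex set $V$ and edge set $E\subseteq\binom{V}{r}$. The degree of a vertex is the number of edges containing it. A walk is a sequence $v_0e_1v_1\cdots e_lv_l$ with $v_{i-1},v_i\in e_i$; $H$ is connected if any two vertices are joined by a walk. The spectral radius is $\rho(H)=\max_{x\in\mathbb{R}^{V}_{\geq 0},x\neq 0} \frac{r!\sum_{e\in E}\prod_{v\in e}x_v}{\sum_{v\in V}x_v^r}$. Hypergraphs are considered up to isomorphism. Special $3$-uniform hypergraphs. A path of length $k\geq1$ is a sequence of edges $e_1,\dots,e_k$ with $|e_i\cap e_{i+1}|=1$ and $e_i\cap e_j=\emptyset$ for $|i-j|\geq 2$. Attaching a pendant path of length $k\geq 1$ at a vertex $v$ means adding new edges $e_1,\dots,e_k$ forming a path of length $k$ with $v\in e_1$, $v\notin e_j$ for $j\geq2$, and all other vertices of the $e_i$ new; length $0$ means adding nothing. A pendant edge is a pendant path of length $1$. - $A^{(3)}_n$: a path of length $n$. - $E^{(3)}_{i,j,k}$: a vertex $v$ with pendant paths of lengths $i,j,k\geq1$ attached at $v$. Aliases: $E^{(3)}_6=E^{(3)}_{1,2,2}$, $E^{(3)}_7=E^{(3)}_{1,2,3}$, $E^{(3)}_8=E^{(3)}_{1,2,4}$, $D^{(3)}_n=E^{(3)}_{1,1,n-2}$. - $F^{(3)}_{i,j,k}$: an edge $\{a,b,c\}$ with pendant paths of lengths $i,j,k$ attached at $a,b,c$ respectively. Aliases: ${D'}^{(3)}_n=F^{(3)}_{1,1,n-3}$,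 $B^{(3)}_n=F^{(3)}_{1,2,n-4}$. - $G^{(3)}_{i,j:k:l,m}$ ($k\geq0$): a path with edges $e_0,\dots,e_{k+1}$; let $u_1,u_2$ be the two vertices of $e_0$ not in $e_1$ and $u_3,u_4$ the two vertices of $e_{k+1}$ not in $e_k$; attach pendant paths of lengths $i,j,l,m$ at $u_1,u_2,u_3,u_4$ respectively. Aliases: ${B'}^{(3)}_n=G^{(3)}_{1,1:(n-6):1,1}$, $\bar B^{(3)}_n=G^{(3)}_{1,1:(n-7):1,2}$. - $BD^{(3)}_n$ ($n\geq5$): a path $e_1,\dots,e_{n-2}$ with a pendant edge attached at the vertex of $e_1\cap e_2$ and a pendant edge attached at the unique vertex of $e_{n-3}$ lying in no other edge of the path. In every case the subscript $n$ is the number of edges. *)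

theory Defs
  imports "HOL-Analysis.Analysis"
begin

section \<open>Uniform hypergraphs\<close>

type_synonym 'a hypergraph = "'a set \<times> 'a set set"

abbreviation verts :: "'a hypergraph \<Rightarrow> 'a set" where "verts H \<equiv> fst H"
abbreviation edges :: "'a hypergraph \<Rightarrow> 'a set set" where "edges H \<equiv> snd H"

definition uniform_hypergraph :: "nat \<Rightarrow> 'a hypergraph \<Rightarrow> bool" where
  "uniform_hypergraph r H \<longleftrightarrow> finite (verts H) \<and> (\<forall>e\<in>edges H. e \<subseteq> verts H \<and> card e = r)"

definition hwalk :: "'a hypergraph \<Rightarrow> 'a list \<Rightarrow> 'a set list \<Rightarrow> bool" where
  "hwalk H vs es \<longleftrightarrow>
     length vs = Suc (length es) \<and> set vs \<subseteq> verts H \<and> set es \<subseteq> edges H \<and>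
     (\<forall>i<length es. vs ! i \<in> es ! i \<and> vs ! Suc i \<in> es ! i)"

definition hconnected :: "'a hypergraph \<Rightarrow> bool" where
  "hconnected H \<longleftrightarrow>
     (\<forall>u\<in>verts H. \<forall>w\<in>verts H. \<exists>vs es. hwalk H vs es \<and> hd vs = u \<and> last vs = w)"

definition hisomorphic :: "'a hypergraph \<Rightarrow> 'b hypergraph \<Rightarrow> bool" where
  "hisomorphic H K \<longleftrightarrow>
     (\<exists>f. bij_betw f (verts H) (verts K) \<and> (\<lambda>e. f ` e) ` edges H = edges K)"

section \<open>The spectral radius\<close>

definition rayleigh :: "nat \<Rightarrow> 'a hypergraph \<Rightarrow> ('a \<Rightarrow> real) \<Rightarrow> real" where
  "rayleigh r H x = fact r * (\<Sum>e\<in>edges H. \<Prod>v\<in>e. x v) / (\<Sum>v\<in>verts H. x v ^ r)"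

definition nonneg_nonzero :: "'a hypergraph \<Rightarrow> ('a \<Rightarrow> real) \<Rightarrow> bool" where
  "nonneg_nonzero H x \<longleftrightarrow> (\<forall>v\<in>verts H. 0 \<le> x v) \<and> (\<exists>v\<in>verts H. x v \<noteq> 0)"

text \<open>The supremum is a maximum; see \<open>spectral_radius_attained\<close> below.\<close>

definition spectral_radius :: "nat \<Rightarrow> 'a hypergraph \<Rightarrow> real" where
  "spectral_radius r H = (SUP x\<in>{x. nonneg_nonzero H x}. rayleigh r H x)"

lemma rayleigh_scale:
  assumes "uniform_hypergraph r H" "c \<noteq> 0"
  shows "rayleigh r H (\<lambda>v. c * x v) = rayleigh r H x"
proof -
  have "(\<Sum>e\<in>edges H. \<Prod>v\<in>e. c * x v) = (\<Sum>e\<in>edges H. c ^ r * (\<Prod>v\<in>e. x v))"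
    using assms by (intro sum.cong) (auto simp: prod.distrib uniform_hypergraph_def)
  then show ?thesis
    using assms(2) by (simp add: rayleigh_def power_mult_distrib flip: sum_distrib_left)
qed

lemma rayleigh_cong:
  assumes "uniform_hypergraph r H" "\<And>v. v \<in> verts H \<Longrightarrow> x v = y v"
  shows "rayleigh r H x = rayleigh r H y"
proof -
  have "(\<Sum>e\<in>edges H. \<Prod>v\<in>e. x v) = (\<Sum>e\<in>edges H. \<Prod>v\<in>e. y v)"
    using assms by (intro sum.cong prod.cong refl) (auto simp: uniform_hypergraph_def)
  moreover have "(\<Sum>v\<in>verts H. x v ^ r) = (\<Sum>v\<in>verts H. y v ^ r)"
    using assms(2) by (intro sum.cong) auto
  ultimately show ?thesis by (simp add: rayleigh_def)
qed

lemma spectral_radius_attained: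
  fixes H :: "'a hypergraph"
  assumes H: "uniform_hypergraph r H" and ne: "verts H \<noteq> {}"
  shows "\<exists>x. nonneg_nonzero H x \<and> rayleigh r H x = spectral_radius r H \<and>
           (\<forall>y. nonneg_nonzero H y \<longrightarrow> rayleigh r H y \<le> spectral_radius r H)"
proof -
  have fin: "finite (verts H)" using H by (simp add: uniform_hypergraph_def)
  define B :: "'a \<Rightarrow> real set" where "B v = (if v \<in> verts H then {0..1} else {0})" for v
  define S where "S x = (\<Sum>v\<in>verts H. x v)" for x :: "'a \<Rightarrow> real"
  define K where "K = PiE UNIV B \<inter> {x. S x = 1}"
  have "compactin (product_topology (\<lambda>_::'a. euclidean :: real topology) UNIV) (PiE UNIV B)"
    by (subst compactin_PiE) (auto simp: B_def compactin_euclidean_iff)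
  then have cpt: "compact (PiE UNIV B)"
    by (simp add: euclidean_product_topology compactin_euclidean_iff)
  have contS: "continuous_on UNIV S"
    unfolding S_def by (intro continuous_on_sum continuous_on_product_coordinates)
  then have "closed {x. S x = 1}"
    using closed_Collect_eq[OF contS continuous_on_const] by simp
  then have K: "compact K" unfolding K_def using cpt by (rule compact_Int_closed[rotated])
  have KB: "nonneg_nonzero H x" if "x \<in> K" for x
  proof -
    have "0 \<le> x v" if "v \<in> verts H" for v
    proof -
      have "x v \<in> B v" using \<open>x \<in> K\<close> by (auto simp: K_def PiE_iff)
      then show ?thesis using that by (simp add: B_def)
    qed
    moreover have "S x = 1" using that by (simp add: K_def)
    then have "\<exists>v\<in>verts H. x v \<noteq> 0" unfolding S_def
      by (metis sum.neutral zero_neq_one)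
    ultimately show ?thesis by (simp add: nonneg_nonzero_def)
  qed
  have pos: "(\<Sum>v\<in>verts H. x v ^ r) > 0" if "nonneg_nonzero H x" for x
  proof -
    have "\<exists>v\<in>verts H. x v > 0"
      using that unfolding nonneg_nonzero_def by (metis less_le)
    then obtain v where v: "v \<in> verts H" "x v > 0" by blast
    then show ?thesis using that v fin
      by (intro sum_pos2[of _ v]) (auto simp: nonneg_nonzero_def)
  qed
  have cont: "continuous_on K (rayleigh r H)"
    unfolding rayleigh_def
  proof (intro continuous_intros ballI)
    show "continuous_on K (\<lambda>x. x v)" for v
      by (rule continuous_on_subset[OF continuous_on_product_coordinates]) simp
    show "continuous_on K (\<lambda>x. x v)" for v
      by (rule continuous_on_subset[OF continuous_on_product_coordinates]) simp
    show "(\<Sum>v\<in>verts H. x v ^ r) \<noteq> 0" if "x \<in> K" for x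
      using pos[OF KB[OF that]] by simp
  qed
  have norm: "\<exists>y\<in>K. rayleigh r H y = rayleigh r H x" if x: "nonneg_nonzero H x" for x
  proof -
    define c where "c = S x"
    have "c > 0"
    proof -
      have "\<exists>v\<in>verts H. x v > 0"
        using x unfolding nonneg_nonzero_def by (metis less_le)
      then obtain v where v: "v \<in> verts H" "x v > 0" by blast
      then show ?thesis using x v fin unfolding c_def S_def
        by (intro sum_pos2[of _ v]) (auto simp: nonneg_nonzero_def)
    qed
    define y where "y v = (if v \<in> verts H then (1 / c) * x v else 0)" for v
    have "x v \<le> c" if "v \<in> verts H" for v
      unfolding c_def S_def using that x fin
      by (intro member_le_sum) (auto simp: nonneg_nonzero_def)
    then have "y v \<in> B v" for v
      using x \<open>c > 0\<close> by (auto simp: y_def B_def nonneg_nonzero_def)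
    moreover have "S y = (\<Sum>v\<in>verts H. (1 / c) * x v)"
      unfolding S_def by (intro sum.cong) (auto simp: y_def)
    then have "S y = 1"
      using \<open>c > 0\<close> by (simp add: c_def S_def flip: sum_divide_distrib)
    ultimately have "y \<in> K" by (simp add: K_def PiE_iff)
    moreover have "rayleigh r H y = rayleigh r H (\<lambda>v. (1 / c) * x v)"
      by (rule rayleigh_cong[OF H]) (simp add: y_def)
    then have "rayleigh r H y = rayleigh r H x"
      using rayleigh_scale[OF H, of "1 / c" x] \<open>c > 0\<close> by simp
    ultimately show ?thesis by blast
  qed
  have "nonneg_nonzero H (\<lambda>_. 1)" using ne by (auto simp: nonneg_nonzero_def)
  then have "K \<noteq> {}" using norm by blast
  from continuous_attains_sup[OF K this cont]
  obtain m where m: "m \<in> K" "\<And>y. y \<in> K \<Longrightarrow> rayleigh r H y \<le> rayleigh r H m" by blast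
  have le: "rayleigh r H y \<le> rayleigh r H m" if "nonneg_nonzero H y" for y
    using norm[OF that] m(2) by metis
  have "spectral_radius r H = rayleigh r H m"
    unfolding spectral_radius_def
    using le KB[OF m(1)] by (intro cSup_eq_maximum) auto
  then show ?thesis using le KB[OF m(1)] by auto
qed

section \<open>Paths and pendant paths in 3-uniform hypergraphs\<close>

definition is_hpath :: "'a set list \<Rightarrow> bool" where
  "is_hpath es \<longleftrightarrow>
     (\<forall>e\<in>set es. card e = 3) \<and>
     (\<forall>i. Suc i < length es \<longrightarrow> card (es ! i \<inter> es ! Suc i) = 1) \<and>
     (\<forall>i j. i + 2 \<le> j \<and> j < length es \<longrightarrow> es ! i \<inter> es ! j = {})"

text \<open>Representatives of the isomorphism classes live on natural numbers; \<open>Suc (Max V)\<close>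
  and its successor are the two new vertices of an attached edge.\<close>

definition attach_edge :: "nat \<Rightarrow> nat hypergraph \<Rightarrow> nat hypergraph" where
  "attach_edge v H =
     (let n = Suc (Max (verts H)) in (verts H \<union> {n, Suc n}, insert {v, n, Suc n} (edges H)))"

fun attach_path :: "nat \<Rightarrow> nat \<Rightarrow> nat hypergraph \<Rightarrow> nat hypergraph" where
  "attach_path v 0 H = H"
| "attach_path v (Suc k) H = attach_path (Suc (Max (verts H))) k (attach_edge v H)"

lemma attach_path_is_pendant_path:
  assumes "finite (verts H)" "v \<in> verts H" "\<forall>e\<in>edges H. e \<subseteq> verts H"
  shows "\<exists>es. length es = k \<and> is_hpath es \<and>
           verts (attach_path v k H) = verts H \<union> \<Union> (set es) \<and>
           edges (attach_path v k H) = edges H \<union> set es \<and>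
           (\<forall>i<k. es ! i \<inter> verts H = (if i = 0 then {v} else {}))"
  using assms
proof (induction k arbitrary: v H)
  case 0
  then show ?case by (intro exI[of _ "[]"]) (auto simp: is_hpath_def)
next
  case (Suc k)
  define n where "n = Suc (Max (verts H))"
  define H' where "H' = attach_edge v H"
  have H': "verts H' = verts H \<union> {n, Suc n}" "edges H' = insert {v, n, Suc n} (edges H)"
    by (simp_all add: H'_def attach_edge_def n_def Let_def)
  have less: "u < n" if "u \<in> verts H" for u
    using Suc.prems(1) that by (simp add: n_def less_Suc_eq_le)
  have "finite (verts H')" "n \<in> verts H'" "\<forall>e\<in>edges H'. e \<subseteq> verts H'"
    using Suc.prems by (auto simp: H')
  from Suc.IH[OF this] obtain es where IH: "length es = k \<and> is_hpath es \<and>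
    verts (attach_path n k H') = verts H' \<union> \<Union> (set es) \<and>
    edges (attach_path n k H') = edges H' \<union> set es \<and>
    (\<forall>i<k. es ! i \<inter> verts H' = (if i = 0 then {n} else {}))" by (rule exE)
  have es: "length es = k" "is_hpath es"
    "verts (attach_path n k H') = verts H' \<union> \<Union> (set es)"
    "edges (attach_path n k H') = edges H' \<union> set es"
    using IH by blast+
  have es_int: "es ! i \<inter> verts H' = (if i = 0 then {n} else {})" if "i < k" for i
    using IH that by (elim conjE allE impE)
  let ?e = "{v, n, Suc n}"
  have v: "v < n" using less Suc.prems(2) .
  have sub: "?e \<subseteq> verts H'" using Suc.prems(2) by (auto simp: H')
  have int: "?e \<inter> es ! i = (if i = 0 then {n} else {})" if "i < k" for i
  proof -
    have "?e \<inter> es ! i = ?e \<inter> (es ! i \<inter> verts H')" using sub by blast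
    also have "\<dots> = (if i = 0 then {n} else {})" by (simp add: es_int[OF that])
    finally show ?thesis .
  qed
  have path: "is_hpath (?e # es)"
    unfolding is_hpath_def
  proof (intro conjI allI impI)
    show "\<forall>e\<in>set (?e # es). card e = 3"
      using es(2) v by (auto simp: is_hpath_def)
    show "card ((?e # es) ! i \<inter> (?e # es) ! Suc i) = 1" if "Suc i < length (?e # es)" for i
    proof (cases i)
      case 0
      then show ?thesis using int[of 0] that es(1) by simp
    next
      case (Suc j)
      then show ?thesis using es(1,2) that by (simp add: is_hpath_def)
    qed
    show "(?e # es) ! i \<inter> (?e # es) ! j = {}" if ij: "i + 2 \<le> j \<and> j < length (?e # es)" for i j
    proof -
      obtain j' where j': "j = Suc j'" using ij by (cases j) auto
      show ?thesis
      proof (cases i)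
        case 0
        then have "j' < k" "j' \<noteq> 0" using ij j' es(1) by auto
        then show ?thesis using int[of j'] 0 j' by simp
      next
        case (Suc i')
        then show ?thesis using es(2) ij j' by (auto simp: is_hpath_def)
      qed
    qed
  qed
  have new: "(?e # es) ! i \<inter> verts H = (if i = 0 then {v} else {})" if "i < Suc k" for i
  proof (cases i)
    case 0
    then show ?thesis using Suc.prems(2) less[of n] less[of "Suc n"] by auto
  next
    case (Suc j)
    then have "j < k" using that by simp
    moreover have "n \<notin> verts H" using less by blast
    moreover have "es ! j \<inter> verts H = es ! j \<inter> verts H' \<inter> verts H" by (auto simp: H')
    ultimately have "es ! j \<inter> verts H = {}" by (simp add: es_int)
    then show ?thesis using Suc by simp
  qed
  have eq: "attach_path v (Suc k) H = attach_path n k H'" by (simp add: H'_def n_def)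
  have V: "verts (attach_path n k H') = verts H \<union> \<Union> (set (?e # es))"
    using es(3) Suc.prems(2) by (auto simp: H')
  have E: "edges (attach_path n k H') = edges H \<union> set (?e # es)"
    using es(4) by (auto simp: H')
  show ?case unfolding eq
    using V E path new es(1) by (intro exI[of _ "?e # es"]) simp
qed

section \<open>The special hypergraphs\<close>

definition path_edge :: "nat \<Rightarrow> nat set" where
  "path_edge i = {2 * i, 2 * i + 1, 2 * i + 2}"

definition hypA :: "nat \<Rightarrow> nat hypergraph" where
  "hypA n = ({0..2 * n}, path_edge ` {..<n})"

lemma is_hpath_path_edge: "is_hpath (map path_edge [0..<n])"
proof -
  have "path_edge i \<inter> path_edge (Suc i) = {2 * i + 2}" for i
    by (auto simp: path_edge_def)
  then show ?thesis by (auto simp: is_hpath_def path_edge_def)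
qed

lemma verts_hypA: "n \<ge> 1 \<Longrightarrow> verts (hypA n) = \<Union> (edges (hypA n))"
proof (induction n rule: dec_induct)
  case base
  show ?case by (auto simp: hypA_def path_edge_def)
next
  case (step n)
  have "{0..2 * Suc n} = {0..2 * n} \<union> path_edge n" by (auto simp: path_edge_def)
  then show ?case using step by (auto simp: hypA_def lessThan_Suc)
qed

definition hypE :: "nat \<Rightarrow> nat \<Rightarrow> nat \<Rightarrow> nat hypergraph" where
  "hypE i j k = attach_path 0 k (attach_path 0 j (attach_path 0 i ({0}, {})))"

definition hypF :: "nat \<Rightarrow> nat \<Rightarrow> nat \<Rightarrow> nat hypergraph" where
  "hypF i j k =
     attach_path 2 k (attach_path 1 j (attach_path 0 i ({0, 1, 2}, {{0, 1, 2}})))"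

text \<open>\<open>hypG i j k l m\<close> is $G_{i,j:k:l,m}$. In the path with edges $e_0,\dots,e_{k+1}$,
  the vertices of $e_0$ outside $e_1$ are $0, 1$, and those of $e_{k+1}$ outside $e_k$
  are $2k+3, 2k+4$.\<close>

definition hypG :: "nat \<Rightarrow> nat \<Rightarrow> nat \<Rightarrow> nat \<Rightarrow> nat \<Rightarrow> nat hypergraph" where
  "hypG i j k l m =
     attach_path (2 * k + 4) m (attach_path (2 * k + 3) l
       (attach_path 1 j (attach_path 0 i (hypA (k + 2)))))"

definition hypE6 :: "nat hypergraph" where "hypE6 = hypE 1 2 2"
definition hypE7 :: "nat hypergraph" where "hypE7 = hypE 1 2 3"
definition hypE8 :: "nat hypergraph" where "hypE8 = hypE 1 2 4"

text \<open>The subtractions below are genuine only from the first admissible index on: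
  $n \ge 3$ for \<open>hypD\<close>, $4$ for \<open>hypD'\<close>, $5$ for \<open>hypB\<close>, $6$ for \<open>hypB'\<close>, $7$ for \<open>hypBbar\<close>
  and $5$ for \<open>hypBD\<close>.\<close>

definition hypD :: "nat \<Rightarrow> nat hypergraph" where "hypD n = hypE 1 1 (n - 2)"
definition hypD' :: "nat \<Rightarrow> nat hypergraph" where "hypD' n = hypF 1 1 (n - 3)"
definition hypB :: "nat \<Rightarrow> nat hypergraph" where "hypB n = hypF 1 2 (n - 4)"
definition hypB' :: "nat \<Rightarrow> nat hypergraph" where "hypB' n = hypG 1 1 (n - 6) 1 1"
definition hypBbar :: "nat \<Rightarrow> nat hypergraph" where "hypBbar n = hypG 1 1 (n - 7) 1 2"

text \<open>In \<open>hypA (n - 2)\<close> the edge $e_i$ (counted from $1$) is \<open>path_edge (i - 1)\<close>, so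
  $e_1 \cap e_2 = \{2\}$ and the middle vertex of $e_{n-3}$ is $2(n-4)+1 = 2n-7$.\<close>

definition hypBD :: "nat \<Rightarrow> nat hypergraph" where
  "hypBD n = attach_path (2 * n - 7) 1 (attach_path 2 1 (hypA (n - 2)))"

end

theory Submission
  imports Defs
begin

text \<open>
  Put \<open>y v = (x v) ^ 3\<close>. A vector \<open>x\<close> witnesses \<open>\<rho>(H) \<ge> \<rho>\<^sub>3\<close> exactly if the sum of
  \<open>3 * root 3 (y a * y b * y c / 4)\<close> over the edges is at least the sum of the \<open>y v\<close>, and such
  witnesses extend by zero from subhypergraphs. Vertex degrees as weights rule out cycles, so \<open>H\<close> is
  a hypertree. For a rooted hypertree the optimal weights are found from the leaves upwards: if the
  branches at a child \<open>u\<close> of an edge require the fraction \<open>l(u)\<close> of the weight of \<open>u\<close>, then the edge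
  requires the fraction \<open>1 / (4 * (1 - l(s)) * (1 - l(t)))\<close> of the weight of its third vertex, and
  \<open>\<rho>(H) < \<rho>\<^sub>3\<close> forces all these fractions to stay below \<open>1\<close>. Such a hypertree is a path, or it can be
  rerooted at a vertex of degree at least \<open>3\<close> or at an edge all of whose vertices have degree at
  least \<open>2\<close>; there the inequalities leave only the listed shapes.
\<close>

section \<open>Tree shapes and their loads\<close>

text \<open>The constant in the bound is critical for paths: along a chain the load obeys
  \<open>l' = 1 / (4 * (1 - l))\<close>, a Moebius map whose only fixed point is \<open>1/2\<close>.
  In the coordinate \<open>1 / (1 - 2 * l)\<close> it is the shift by \<open>1\<close>, so the load
  of a path climbs towards \<open>1/2\<close> and never reaches it. Hence a path branch may be
  arbitrarily long exactly if the rest of the tree leaves it at least \<open>1/2\<close>; this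
  separates the infinite families from the exceptional hypergraphs, whose length bounds come from a
  budget below \<open>1/2\<close>. Loads above \<open>1/2\<close> move away from \<open>1/2\<close>
  along a chain, which bounds the length of some chains between two branching edges. The load
  depends on the root, whereas the classification needs a root at the branching. What makes
  rerooting possible is that the condition at an edge, cleared of denominators, says that the
  residuals \<open>1 - load\<close> of its three vertices have product above \<open>1/4\<close>. The
  weights built from the loads act only as test vectors, so everything rests on lower bounds for the
  spectral radius.\<close>

text \<open>\<open>Join a b c\<close> is the tree \<open>a\<close> with one more edge \<open>{r, s, t}\<close> at its root \<open>r\<close>, where \<open>s\<close> and
  \<open>t\<close> are the roots of \<open>b\<close> and \<open>c\<close>; so the three arguments play symmetric roles up to the choice of
  the root.\<close>

datatype htree = Leaf | Join htree htree htree

definition edge_load :: "real \<Rightarrow> real \<Rightarrow> real" where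
  "edge_load x y = inverse (1 - x) * inverse (1 - y) / 4"

fun load :: "htree \<Rightarrow> real" where
  "load Leaf = 0"
| "load (Join a b c) = load a + edge_load (load b) (load c)"

text \<open>Goodness of all three branches keeps \<open>1 - load b\<close> and
  \<open>1 - load c\<close> positive, so that \<open>edge_load\<close> is a genuine positive demand
  at every edge of a good tree.\<close>

fun good :: "htree \<Rightarrow> bool" where
  "good Leaf \<longleftrightarrow> True"
| "good (Join a b c) \<longleftrightarrow> good a \<and> good b \<and> good c \<and> load (Join a b c) < 1"

section \<open>Isomorphism of tree shapes\<close>

text \<open>A term fixes an order of the edges at a vertex and of the two far ends of an edge; the
  last two rules undo these choices.\<close>

inductive rooted_iso :: "htree \<Rightarrow> htree \<Rightarrow> bool" where
  rooted_iso_refl: "rooted_iso a a"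
| rooted_iso_trans: "rooted_iso a b \<Longrightarrow> rooted_iso b c \<Longrightarrow> rooted_iso a c"
| rooted_iso_cong: "rooted_iso a a' \<Longrightarrow> rooted_iso b b' \<Longrightarrow> rooted_iso c c' \<Longrightarrow> rooted_iso (Join a b c) (Join a' b' c')"
| rooted_iso_swap: "rooted_iso (Join a b c) (Join a c b)"
| rooted_iso_comm: "rooted_iso (Join (Join a b c) d e) (Join (Join a d e) b c)"

text \<open>There is no congruence rule: moving the root inside a proper subtree would change the
  vertex at which that subtree hangs.\<close>

inductive unrooted_iso :: "htree \<Rightarrow> htree \<Rightarrow> bool" where
  unrooted_iso_rooted_iso: "rooted_iso a b \<Longrightarrow> unrooted_iso a b"
| unrooted_iso_rot: "unrooted_iso (Join a b c) (Join b a c)"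
| unrooted_iso_trans: "unrooted_iso a b \<Longrightarrow> unrooted_iso b c \<Longrightarrow> unrooted_iso a c"

declare rooted_iso_refl [simp] rooted_iso_trans [trans] unrooted_iso_trans [trans]

lemma rooted_iso_unrooted_iso_trans [trans]: "rooted_iso a b \<Longrightarrow> unrooted_iso b c \<Longrightarrow> unrooted_iso a c"
  and unrooted_iso_rooted_iso_trans [trans]: "unrooted_iso a b \<Longrightarrow> rooted_iso b c \<Longrightarrow> unrooted_iso a c"
  by (blast intro: unrooted_iso.intros)+

lemma rooted_iso_sym: "rooted_iso a b \<Longrightarrow> rooted_iso b a"
  by (induction rule: rooted_iso.induct) (auto intro: rooted_iso.intros)

lemma unrooted_iso_refl: "unrooted_iso a a"
  by (simp add: rooted_iso_refl unrooted_iso_rooted_iso)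

section \<open>Goodness as an isomorphism invariant\<close>

lemma good_bounds: "good a \<Longrightarrow> 0 \<le> load a \<and> load a < 1"
  by (induction a) (auto intro!: add_nonneg_nonneg simp: edge_load_def)

lemma good_load_nonneg: "good a \<Longrightarrow> 0 \<le> load a"
  and good_load_less: "good a \<Longrightarrow> load a < 1"
  using good_bounds by auto

lemma edge_load_commute: "edge_load x y = edge_load y x"
  by (simp add: edge_load_def algebra_simps)

lemma edge_load_pos: "x < 1 \<Longrightarrow> y < 1 \<Longrightarrow> 0 < edge_load x y"
  by (simp add: edge_load_def)

lemma edge_load_less_iff:
  assumes "x < 1" "y < 1"
  shows "edge_load x y < z \<longleftrightarrow> 1 / 4 < z * (1 - x) * (1 - y)"
proof -
  define p where "p = (1 - x) * (1 - y)"
  have "p > 0" using assms by (simp add: p_def)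
  moreover have "edge_load x y = inverse p / 4"
    by (simp add: edge_load_def p_def)
  moreover have "z * (1 - x) * (1 - y) = z * p" by (simp add: p_def)
  ultimately show ?thesis by (simp only:) (simp add: field_simps)
qed

text \<open>Clearing denominators makes the condition symmetric in the three vertices of the edge;
  this is why goodness survives a change of root.\<close>

lemma good_Join_iff:
  "good (Join a b c) \<longleftrightarrow>
     good a \<and> good b \<and> good c \<and> 1 / 4 < (1 - load a) * (1 - load b) * (1 - load c)"
  using good_load_less edge_load_less_iff[of "load b" "load c" "1 - load a"] by auto

lemma load_rooted_iso: "rooted_iso a b \<Longrightarrow> load a = load b"
  by (induction rule: rooted_iso.induct) (auto simp: edge_load_commute)

text \<open>The load at a root is a sum over its edges, so the order of the edges affects only the
  partial sums; each of these stays below \<open>1\<close> because the omitted summands are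
  positive.\<close>

lemma good_comm:
  assumes "good (Join (Join a b c) d e)"
  shows "good (Join (Join a d e) b c)"
proof -
  have "load (Join (Join a d e) b c) = load (Join (Join a b c) d e)" by simp
  moreover have "edge_load (load b) (load c) > 0"
    using assms good_load_less by (intro edge_load_pos) auto
  ultimately show ?thesis using assms by auto
qed

lemma good_rooted_iso: "rooted_iso a b \<Longrightarrow> good a = good b"
proof (induction rule: rooted_iso.induct)
  case (rooted_iso_cong a a' b b' c c')
  then show ?case by (simp add: load_rooted_iso)
next
  case (rooted_iso_swap a b c)
  show ?case by (auto simp: edge_load_commute)
next
  case (rooted_iso_comm a b c d e)
  show ?case using good_comm by blast
qed auto

lemma good_unrooted_iso: "unrooted_iso a b \<Longrightarrow> good a = good b"
  by (induction rule: unrooted_iso.induct) (simp_all add: good_rooted_iso good_Join_iff mult_ac conj_ac del: good.simps(2))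

section \<open>Gluing trees at their roots and moving the root\<close>

fun graft :: "htree \<Rightarrow> htree \<Rightarrow> htree" where
  "graft r Leaf = r"
| "graft r (Join a b c) = Join (graft r a) b c"

lemma graft_Leaf [simp]: "graft Leaf a = a"
  by (induction a) auto

lemma graft_Join_rooted_iso: "rooted_iso (graft (Join r b c) a) (Join (graft r a) b c)"
proof (induction a)
  case (Join a d e)
  have "rooted_iso (Join (graft (Join r b c) a) d e) (Join (Join (graft r a) b c) d e)"
    by (intro rooted_iso_cong Join rooted_iso_refl)
  also have "rooted_iso \<dots> (Join (Join (graft r a) d e) b c)" by (rule rooted_iso_comm)
  finally show ?case by simp
qed simp

lemma graft_commute: "rooted_iso (graft a b) (graft b a)"
proof (induction b)
  case (Join b c d)
  have "rooted_iso (graft a (Join b c d)) (Join (graft b a) c d)" by (simp add: Join rooted_iso_cong)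
  also have "rooted_iso \<dots> (graft (Join b c d) a)" by (rule rooted_iso_sym[OF graft_Join_rooted_iso])
  finally show ?case .
qed simp

lemma graft_rooted_iso: "rooted_iso a a' \<Longrightarrow> rooted_iso (graft a b) (graft a' b)"
  by (induction b) (auto intro: rooted_iso_cong)

lemma graft_rooted_iso2: "rooted_iso b b' \<Longrightarrow> rooted_iso (graft a b) (graft a b')"
  by (meson graft_commute graft_rooted_iso rooted_iso_trans)

text \<open>The root is the near end of the path of \<open>n\<close> edges, and \<open>a\<close>
  hangs at the far end.\<close>

fun chain :: "nat \<Rightarrow> htree \<Rightarrow> htree" where
  "chain 0 a = a"
| "chain (Suc n) a = Join Leaf Leaf (chain n a)"

abbreviation path_tree :: "nat \<Rightarrow> htree" where
  "path_tree n \<equiv> chain n Leaf"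

lemma chain_chain: "chain m (chain n a) = chain (m + n) a"
  by (induction m) auto

lemma unrooted_iso_rot2: "unrooted_iso (Join a b c) (Join c b a)"
  by (meson rooted_iso_swap unrooted_iso_rooted_iso unrooted_iso_rot unrooted_iso_trans)

text \<open>Both sides are a chain of \<open>k\<close> edges with \<open>r\<close> at one end and
  \<open>a\<close> at the other, rooted at opposite ends. The induction moves the root across one
  edge at a time and adds the edge passed over to \<open>r\<close>.\<close>

lemma graft_chain_reverse: "unrooted_iso (graft r (chain k a)) (graft a (chain k r))"
proof (induction k arbitrary: r)
  case 0
  then show ?case by (simp add: graft_commute unrooted_iso_rooted_iso)
next
  case (Suc k)
  have "unrooted_iso (graft r (chain (Suc k) a)) (Join (chain k a) Leaf r)" by (simp add: unrooted_iso_rot2)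
  also have "rooted_iso \<dots> (graft (Join Leaf Leaf r) (chain k a))"
    using graft_Join_rooted_iso[of Leaf Leaf r "chain k a", THEN rooted_iso_sym] by simp
  also have "unrooted_iso \<dots> (graft a (chain k (Join Leaf Leaf r)))" by (rule Suc)
  also have "chain k (Join Leaf Leaf r) = chain (Suc k) r"
    using chain_chain[of k 1 r] by simp
  finally show ?case .
qed

lemma two_paths: "unrooted_iso (graft (path_tree i) (path_tree j)) (path_tree (i + j))"
  using graft_chain_reverse[of "path_tree i" j Leaf] by (simp add: chain_chain add.commute)

text \<open>Nested first arguments list the edges at the root, so the first case is a root of degree
  at least \<open>3\<close>; the second is an edge each of whose vertices lies in a further
  edge.\<close>

definition branched :: "htree \<Rightarrow> bool" where
  "branched t \<longleftrightarrow>
     (\<exists>a b c d e f g. t = Join (Join (Join a b c) d e) f g) \<or>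
     (\<exists>a b c. t = Join a b c \<and> a \<noteq> Leaf \<and> b \<noteq> Leaf \<and> c \<noteq> Leaf)"

lemma nonLeaf_graft: "r \<noteq> Leaf \<Longrightarrow> graft r a \<noteq> Leaf"
  by (cases a) auto

lemma rooted_iso_Leaf: "rooted_iso a b \<Longrightarrow> a = Leaf \<longleftrightarrow> b = Leaf"
  by (induction rule: rooted_iso.induct) auto

text \<open>The nontrivial rest \<open>r\<close> glued to the root of \<open>t\<close> makes the statement inductive: moving the root
  into a subtree that is not a path only changes \<open>r\<close>.\<close>

lemma path_or_branched:
  "(\<exists>k. rooted_iso t (path_tree k)) \<or> (\<forall>r. r \<noteq> Leaf \<longrightarrow> (\<exists>t'. unrooted_iso (graft r t) t' \<and> branched t'))"
proof (induction t)
  case Leaf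
  then show ?case by (metis chain.simps(1) rooted_iso_refl)
next
  case (Join a b c)
  let ?branch = "\<forall>r. r \<noteq> Leaf \<longrightarrow> (\<exists>t'. unrooted_iso (graft r (Join a b c)) t' \<and> branched t')"
  consider (a) "\<forall>r. r \<noteq> Leaf \<longrightarrow> (\<exists>t'. unrooted_iso (graft r a) t' \<and> branched t')"
    | (b) "\<forall>r. r \<noteq> Leaf \<longrightarrow> (\<exists>t'. unrooted_iso (graft r b) t' \<and> branched t')"
    | (c) "\<forall>r. r \<noteq> Leaf \<longrightarrow> (\<exists>t'. unrooted_iso (graft r c) t' \<and> branched t')"
    | (paths) i j k where "rooted_iso a (path_tree i)" "rooted_iso b (path_tree j)" "rooted_iso c (path_tree k)"
    using Join by blast
  then show ?case
  proof cases
    case a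
    have ?branch
    proof (intro allI impI)
      fix r
      obtain t' where "unrooted_iso (graft (Join r b c) a) t'" "branched t'"
        using a by blast
      moreover have "unrooted_iso (graft r (Join a b c)) (graft (Join r b c) a)"
        using graft_Join_rooted_iso rooted_iso_sym unrooted_iso_rooted_iso by auto
      ultimately show "\<exists>t'. unrooted_iso (graft r (Join a b c)) t' \<and> branched t'"
        using unrooted_iso_trans by blast
    qed
    then show ?thesis ..
  next
    case b
    have ?branch
    proof (intro allI impI)
      fix r
      obtain t' where "unrooted_iso (graft (Join Leaf (graft r a) c) b) t'" "branched t'"
        using b by blast
      moreover have "unrooted_iso (graft r (Join a b c)) (Join b (graft r a) c)"
        by (simp add: unrooted_iso_rot)
      moreover have "rooted_iso \<dots> (graft (Join Leaf (graft r a) c) b)"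
        using graft_Join_rooted_iso rooted_iso_sym by (metis graft_Leaf)
      ultimately show "\<exists>t'. unrooted_iso (graft r (Join a b c)) t' \<and> branched t'"
        using unrooted_iso_trans unrooted_iso_rooted_iso by blast
    qed
    then show ?thesis ..
  next
    case c
    have ?branch
    proof (intro allI impI)
      fix r
      obtain t' where "unrooted_iso (graft (Join Leaf b (graft r a)) c) t'" "branched t'"
        using c by blast
      moreover have "unrooted_iso (graft r (Join a b c)) (Join c b (graft r a))"
        by (simp add: unrooted_iso_rot2)
      moreover have "rooted_iso \<dots> (graft (Join Leaf b (graft r a)) c)"
        using graft_Join_rooted_iso rooted_iso_sym by (metis graft_Leaf)
      ultimately show "\<exists>t'. unrooted_iso (graft r (Join a b c)) t' \<and> branched t'"
        using unrooted_iso_trans unrooted_iso_rooted_iso by blast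
    qed
    then show ?thesis ..
  next
    case paths
    show ?thesis
    \<comment> \<open>All three subtrees are paths here. If \<open>a\<close> is not a leaf, the root
      lies in an edge of \<open>r\<close>, in an edge of \<open>a\<close> and in the outermost edge.
      If \<open>a\<close> is a leaf, either the tree is itself a path, or with \<open>r\<close>
      glued on all three vertices of the outermost edge branch.\<close>
    proof (cases "a = Leaf")
      case True
      show ?thesis
      proof (cases "b = Leaf \<or> c = Leaf")
        case True
        then have "rooted_iso (Join a b c) (path_tree (Suc k)) \<or> rooted_iso (Join a b c) (path_tree (Suc j))"
          using paths \<open>a = Leaf\<close>
          by (metis chain.simps(2) rooted_iso_cong rooted_iso_refl rooted_iso_swap rooted_iso_trans)
        then show ?thesis by blast
      next
        case False
        then have "branched (graft r (Join a b c))" if "r \<noteq> Leaf" for r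
          using that nonLeaf_graft by (auto simp: branched_def)
        then show ?thesis using unrooted_iso_refl by blast
      qed
    next
      case False
      have "\<exists>t'. unrooted_iso (graft r (Join a b c)) t' \<and> branched t'" if nl: "r \<noteq> Leaf" for r
      proof -
        obtain r1 r2 r3 where r: "r = Join r1 r2 r3" using nl by (cases r) auto
        obtain a1 a2 a3 where a: "a = Join a1 a2 a3" using False by (cases a) auto
        have "graft r (Join a b c) = Join (Join (graft r a1) a2 a3) b c" using a by simp
        moreover have "rooted_iso \<dots> (Join (Join (Join (graft r1 a1) r2 r3) a2 a3) b c)"
          unfolding r by (intro rooted_iso_cong graft_Join_rooted_iso rooted_iso_refl)
        moreover have "branched \<dots>" by (auto simp: branched_def)
        ultimately show ?thesis using unrooted_iso_rooted_iso by metis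
      qed
      then show ?thesis by blast
    qed
  qed
qed

text \<open>For each subtree, the outermost edge with the other two subtrees serves as the
  nontrivial rest \<open>r\<close> of \<open>path_or_branched\<close>. If this never produces a
  branching, all three subtrees are paths and one of them is empty, so the other two join up through
  the edge into one path.\<close>

lemma unrooted_path_or_branched:
  "(\<exists>k. unrooted_iso t (path_tree k)) \<or> (\<exists>t'. unrooted_iso t t' \<and> branched t')"
proof (cases t)
  case Leaf
  then show ?thesis by (metis chain.simps(1) unrooted_iso_refl)
next
  case (Join a b c)
  let ?B = "\<exists>t'. unrooted_iso t t' \<and> branched t'"
  have a: ?B if "\<forall>r. r \<noteq> Leaf \<longrightarrow> (\<exists>t'. unrooted_iso (graft r a) t' \<and> branched t')"
  proof -
    have "rooted_iso t (graft (Join Leaf b c) a)"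
      using graft_Join_rooted_iso[of Leaf b c a, THEN rooted_iso_sym] Join by simp
    then show ?thesis using that unrooted_iso_trans unrooted_iso_rooted_iso by blast
  qed
  have b: ?B if "\<forall>r. r \<noteq> Leaf \<longrightarrow> (\<exists>t'. unrooted_iso (graft r b) t' \<and> branched t')"
  proof -
    have "unrooted_iso t (graft (Join Leaf a c) b)"
      using graft_Join_rooted_iso[of Leaf a c b, THEN rooted_iso_sym] Join unrooted_iso_rot[of a b c]
        unrooted_iso_rooted_iso_trans by simp
    then show ?thesis using that unrooted_iso_trans by blast
  qed
  have c: ?B if "\<forall>r. r \<noteq> Leaf \<longrightarrow> (\<exists>t'. unrooted_iso (graft r c) t' \<and> branched t')"
  proof -
    have "unrooted_iso t (graft (Join Leaf b a) c)"
      using graft_Join_rooted_iso[of Leaf b a c, THEN rooted_iso_sym] Join unrooted_iso_rot2[of a b c]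
        unrooted_iso_rooted_iso_trans by simp
    then show ?thesis using that unrooted_iso_trans by blast
  qed
  show ?thesis
  proof (cases ?B)
    case False
    then obtain i j k where p: "rooted_iso a (path_tree i)" "rooted_iso b (path_tree j)" "rooted_iso c (path_tree k)"
      using a b c path_or_branched by metis
    have l: "\<exists>k. unrooted_iso (Join x Leaf z) (path_tree k)" if "rooted_iso x (path_tree m)" "rooted_iso z (path_tree n)" for x z m n
    proof -
      have "rooted_iso (Join x Leaf z) (graft (path_tree m) (path_tree (Suc n)))"
        using that by (auto intro: rooted_iso_cong)
      then show ?thesis using two_paths unrooted_iso_rooted_iso unrooted_iso_trans by metis
    qed
    have "a = Leaf \<or> b = Leaf \<or> c = Leaf"
      using False Join unrooted_iso_refl[of t] by (auto simp: branched_def)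
    then have "\<exists>k. unrooted_iso t (path_tree k)"
    proof (elim disjE)
      assume "a = Leaf"
      then show ?thesis using l[OF p(2) p(3)] unrooted_iso_rot Join unrooted_iso_trans by metis
    next
      assume "b = Leaf"
      then show ?thesis using l[OF p(1) p(3)] Join by metis
    next
      assume "c = Leaf"
      then show ?thesis using l[OF p(1) p(2)] Join unrooted_iso_trans rooted_iso_swap unrooted_iso_rooted_iso by metis
    qed
    then show ?thesis ..
  qed simp
qed

section \<open>Trees of small load\<close>

lemma edge_load_mono:
  assumes "x \<le> x'" "y \<le> y'" "x' < 1" "y' < 1"
  shows "edge_load x y \<le> edge_load x' y'"
  unfolding edge_load_def using assms
  by (intro divide_right_mono mult_mono le_imp_inverse_le) auto

lemma edge_load_ge: "good b \<Longrightarrow> good c \<Longrightarrow> 1 / 4 \<le> edge_load (load b) (load c)"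
  using edge_load_mono[of 0 "load b" 0 "load c"] good_bounds by (auto simp: edge_load_def)

lemma load_ge_quarter:
  assumes "good t" "t \<noteq> Leaf"
  shows "1 / 4 \<le> load t"
proof (cases t)
  case (Join a b c)
  then show ?thesis using assms(1) edge_load_ge[of b c] good_load_nonneg[of a] by simp
qed (use assms in simp)

lemma load_less_quarter: "good t \<Longrightarrow> load t < 1 / 4 \<Longrightarrow> t = Leaf"
  using load_ge_quarter by force

text \<open>A child that is not a leaf has load at least \<open>1/4\<close>, and then the edge
  already demands \<open>1 / (4 * (3/4)) = 1/3\<close>.\<close>

lemma edge_load_less_third:
  assumes "good b" "good c" "edge_load (load b) (load c) < 1 / 3"
  shows "b = Leaf" "c = Leaf"
proof -
  have leaf: "b = Leaf" if g: "good b" "good c" and l: "edge_load (load b) (load c) < 1 / 3" for b c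
  proof (rule load_less_quarter[OF g(1)])
    have "edge_load (load b) 0 \<le> edge_load (load b) (load c)"
      using g good_bounds by (intro edge_load_mono) auto
    then show "load b < 1 / 4"
      using l good_load_less[OF g(1)] edge_load_less_iff[of "load b" 0 "1/3"] by simp
  qed
  show "b = Leaf" "c = Leaf"
    using assms leaf[of b c] leaf[of c b] edge_load_commute by auto
qed

lemma load_less_third:
  assumes "good t" "t \<noteq> Leaf" "load t < 1 / 3"
  shows "t = path_tree 1"
proof (cases t)
  case (Join a b c)
  have g: "good a" "good b" "good c" using assms(1) Join by auto
  have l: "load a + edge_load (load b) (load c) < 1 / 3" using assms(3) Join by simp
  have "a = Leaf" using l edge_load_ge[OF g(2,3)] by (intro load_less_quarter g) auto
  moreover have "b = Leaf" "c = Leaf"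
    using l edge_load_less_third[OF g(2,3)] good_load_nonneg[OF g(1)] by auto
  ultimately show ?thesis using Join by simp
qed (use assms in simp)

text \<open>The sibling \<open>b\<close> is replaced by the least load of a nonleaf,
  \<open>1/4\<close>; what the edge can still afford bounds \<open>c\<close>.\<close>

lemma edge_load_less_nonLeaf:
  assumes "good b" "good c" "b \<noteq> Leaf" "edge_load (load b) (load c) < z" "z > 0"
  shows "1 / (3 * z) < 1 - load c"
proof -
  have "edge_load (1 / 4) (load c) \<le> edge_load (load b) (load c)"
    using assms good_bounds load_ge_quarter by (intro edge_load_mono) auto
  then have "edge_load (1 / 4) (load c) < z" using assms(4) by simp
  then have "1 / 4 < z * (1 - 1 / 4) * (1 - load c)"
    using edge_load_less_iff[of "1/4" "load c" z] good_load_less[OF assms(2)] by simp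
  then show ?thesis using assms(5) by (simp add: field_simps)
qed

abbreviation fork :: "nat \<Rightarrow> nat \<Rightarrow> htree" where
  "fork i j \<equiv> Join Leaf (path_tree i) (path_tree j)"

text \<open>The bound \<open>1/2\<close> is the fixed point of the chain recursion, so it passes
  unchanged from an edge with one branch to that branch. An edge with two branches fits only if both
  have load below \<open>1/3\<close>, hence are single edges, and then the recursion ends.\<close>

lemma load_less_half:
  assumes "good t" "load t < 1 / 2"
  shows "(\<exists>k. rooted_iso t (path_tree k)) \<or> (\<exists>k. rooted_iso t (chain k (fork 1 1)))"
  using assms
proof (induction t)
  case Leaf
  then show ?case by (metis chain.simps(1) rooted_iso_refl)
next
  case (Join a b c)
  have g: "good a" "good b" "good c" using Join.prems by auto
  have l: "load a + edge_load (load b) (load c) < 1 / 2" using Join.prems by simp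
  have a: "a = Leaf" using l edge_load_ge[OF g(2,3)] by (intro load_less_quarter g) auto
  have e: "edge_load (load b) (load c) < 1 / 2" using l good_load_nonneg[OF g(1)] by simp
  have step: "(\<exists>k. rooted_iso (Join a Leaf d) (path_tree k)) \<or> (\<exists>k. rooted_iso (Join a Leaf d) (chain k (fork 1 1)))"
    if "(\<exists>k. rooted_iso d (path_tree k)) \<or> (\<exists>k. rooted_iso d (chain k (fork 1 1)))" for d
    using that unfolding a by (metis chain.simps(2) rooted_iso_cong rooted_iso_refl)
  have half: "load d < 1 / 2" if "good d" "edge_load 0 (load d) < 1 / 2" for d
    using that edge_load_less_iff[of 0 "load d" "1/2"] good_load_less by simp
  show ?case
  proof (cases "b = Leaf \<or> c = Leaf")
    case True
    then show ?thesis
    proof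
      assume "b = Leaf"
      then show ?thesis using step[of c] Join.IH(3) g half[of c] e by simp
    next
      assume c: "c = Leaf"
      then have "load b < 1 / 2" using half[of b] g e edge_load_commute by simp
      then show ?thesis using step[of b] Join.IH(2) g c rooted_iso_swap rooted_iso_trans by metis
    qed
  next
    case False
    have "load c < 1 / 3" "load b < 1 / 3"
      using edge_load_less_nonLeaf[of b c "1/2"] edge_load_less_nonLeaf[of c b "1/2"] g e False
      by (simp_all add: edge_load_commute)
    then have "b = path_tree 1" "c = path_tree 1" using load_less_third g False by blast+
    then show ?thesis using a by (metis chain.simps(1) rooted_iso_refl)
  qed
qed

text \<open>Along the chain \<open>1 / (1 - 2 * l)\<close> grows by \<open>1\<close> with every
  edge, starting from \<open>1\<close>.\<close>

lemma load_path: "load (path_tree k) = real k / (2 * (real k + 1))"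
proof (induction k)
  case (Suc k)
  have "1 - load (path_tree k) = (real k + 2) / (2 * (real k + 1))"
    unfolding Suc by (simp add: field_simps)
  then have "load (path_tree (Suc k)) = inverse ((real k + 2) / (2 * (real k + 1))) / 4"
    by (simp add: edge_load_def)
  then show ?case by (simp only:) (simp add: field_simps)
qed simp

text \<open>\<open>fork 1 1\<close> has load \<open>4/9\<close>, the load of a path with
  \<open>8\<close> edges, so this is \<open>load_path\<close> with \<open>k\<close> replaced by
  \<open>k + 8\<close>.\<close>

lemma load_chain_fork: "load (chain k (fork 1 1)) = (real k + 8) / (2 * (real k + 9))"
proof (induction k)
  case (Suc k)
  have "1 - load (chain k (fork 1 1)) = (real k + 10) / (2 * (real k + 9))"
    unfolding Suc by (simp add: field_simps)
  then have "load (chain (Suc k) (fork 1 1)) = inverse ((real k + 10) / (2 * (real k + 9))) / 4"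
    by (simp add: edge_load_def)
  then show ?case by (simp only:) (simp add: field_simps)
qed (simp add: edge_load_def)

lemma load_chain_fork_ge: "4 / 9 \<le> load (chain k (fork 1 1))"
  unfolding load_chain_fork by (simp add: field_simps)

lemma load_path_less_iff:
  "load (path_tree k) < z \<longleftrightarrow> real k < 2 * z * (real k + 1)"
  unfolding load_path by (simp add: field_simps)

lemma load_path_values:
  "load (path_tree (Suc 0)) = 1 / 4" "load (path_tree 1) = 1 / 4" "load (path_tree 2) = 1 / 3" "load (path_tree 3) = 3 / 8"
  "load (path_tree 4) = 2 / 5" "load (path_tree 5) = 5 / 12"
  unfolding load_path by simp_all

lemma load_less_four_ninths:
  assumes "good t" "load t < 4 / 9"
  shows "\<exists>k. rooted_iso t (path_tree k)"
proof -
  have "\<not> rooted_iso t (chain k (fork 1 1))" for k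
    using load_rooted_iso[of t "chain k (fork 1 1)"] load_chain_fork_ge[of k] assms(2) by auto
  then show ?thesis using load_less_half[of t] assms by auto
qed

text \<open>The threshold starts at \<open>5/9\<close>, what a branching edge with two pendant edges leaves over; passing an
  edge of a chain replaces the threshold for \<open>k\<close> by the one for \<open>k + 1\<close>.\<close>

lemma load_less_five_ninths:
  assumes "good t" "load t < (real k + 10) / (2 * (real k + 9))"
  shows "\<exists>n b. rooted_iso t (chain n b) \<and>
           (b \<in> {Leaf, graft (path_tree 1) (path_tree 1), fork 1 1, fork 1 2} \<or> b = fork 1 3 \<and> n + k \<le> 5)"
  using assms
proof (induction t arbitrary: k)
  case Leaf
  then show ?case by (intro exI[of _ 0] exI[of _ Leaf]) simp
next
  case (Join a b c)
  let ?z = "(real k + 10) / (2 * (real k + 9))"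
  let ?shape = "\<lambda>n b k. b \<in> {Leaf, graft (path_tree 1) (path_tree 1), fork 1 1, fork 1 2} \<or> b = fork 1 3 \<and> n + k \<le> 5"
  have z: "?z \<le> 5 / 9" by (simp add: field_simps)
  have g: "good a" "good b" "good c" using Join.prems by auto
  have l: "load a + edge_load (load b) (load c) < ?z" using Join.prems by simp
  show ?case
  proof (cases "a = Leaf")
    case False
    \<comment> \<open>Each of the two summands is at least \<open>1/4\<close>, and
      \<open>5/9 - 1/4 = 11/36\<close> is less than \<open>1/3\<close>.\<close>
    have "load a < 1 / 3" "edge_load (load b) (load c) < 1 / 3"
      using l z load_ge_quarter[OF g(1) False] edge_load_ge[OF g(2,3)] by linarith+
    then have "a = path_tree 1" "b = Leaf" "c = Leaf"
      using load_less_third[OF g(1) False] edge_load_less_third[OF g(2,3)] by blast+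
    then show ?thesis by (intro exI[of _ 0] exI[of _ "graft (path_tree 1) (path_tree 1)"]) simp
  next
    case a: True
    have e: "edge_load (load b) (load c) < ?z" using l good_load_nonneg[OF g(1)] by simp
    have step: "\<exists>n b. rooted_iso (Join a Leaf d) (chain n b) \<and> ?shape n b k"
      if IH: "\<exists>n b. rooted_iso d (chain n b) \<and> ?shape n b (Suc k)" for d
    proof -
      obtain n b where "rooted_iso d (chain n b)" "?shape n b (Suc k)" using IH by blast
      then have "rooted_iso (Join a Leaf d) (chain (Suc n) b)" "?shape (Suc n) b k"
        unfolding a by (auto intro: rooted_iso_cong)
      then show ?thesis by blast
    qed
    have less: "load d < (real (Suc k) + 10) / (2 * (real (Suc k) + 9))"
      if "good d" "edge_load 0 (load d) < ?z" for d
      using that edge_load_less_iff[of 0 "load d" ?z] good_load_less[OF that(1)]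
      by (simp add: field_simps)
    show ?thesis
    proof (cases "b = Leaf \<or> c = Leaf")
      case True
      then show ?thesis
      proof
        assume b: "b = Leaf"
        have "load c < (real (Suc k) + 10) / (2 * (real (Suc k) + 9))"
          using less[of c] g e b by simp
        then show ?thesis using step[OF Join.IH(3)[OF g(3)]] b by blast
      next
        assume c: "c = Leaf"
        have "load b < (real (Suc k) + 10) / (2 * (real (Suc k) + 9))"
          using less[of b] g e c edge_load_commute by simp
        then show ?thesis using step[OF Join.IH(2)[OF g(2)]] c rooted_iso_swap rooted_iso_trans by metis
      qed
    next
      case False
      have e': "edge_load (load b) (load c) < 5 / 9" using e z by linarith
      \<comment> \<open>A branching edge leaves each child less than \<open>1 - 3/5 = 2/5\<close>,
        which is the load of a path with \<open>4\<close> edges.\<close>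
      have short: "\<exists>i\<in>{1,2,3}. rooted_iso d (path_tree i)" if d: "good d" "d \<noteq> Leaf" "3 / 5 < 1 - load d" for d
      proof -
        obtain i where i: "rooted_iso d (path_tree i)"
          using load_less_four_ninths[of d] d by auto
        have "real i < 4" using d(3) load_rooted_iso[OF i] load_path_less_iff[of i "2/5"] by simp
        moreover have "i \<noteq> 0" using d(2) rooted_iso_Leaf[OF i] by (cases i) auto
        ultimately have "i = 1 \<or> i = 2 \<or> i = 3" by linarith
        then show ?thesis using i by auto
      qed
      have "3 / 5 < 1 - load c" "3 / 5 < 1 - load b"
        using edge_load_less_nonLeaf[of b c "5/9"] edge_load_less_nonLeaf[of c b "5/9"] g e' False
        by (simp_all add: edge_load_commute)
      then obtain i j where i: "i \<in> {1,2,3}" "rooted_iso b (path_tree i)" and j: "j \<in> {1,2,3}" "rooted_iso c (path_tree j)"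
        using short g False by meson
      have w: "edge_load (load (path_tree i)) (load (path_tree j)) < ?z"
        using e load_rooted_iso i(2) j(2) by simp
      have w1: "edge_load (load (path_tree i)) (load (path_tree j)) < 5 / 9" using w z by linarith
      have rooted_iso: "rooted_iso (Join a b c) (fork i j)" "rooted_iso (Join a b c) (fork j i)"
        unfolding a
        using rooted_iso_cong[OF rooted_iso_refl i(2) j(2)] rooted_iso_trans[OF rooted_iso_swap rooted_iso_cong[OF rooted_iso_refl j(2) i(2)]]
        by blast+
      \<comment> \<open>\<open>fork 1 3\<close> has load \<open>8/15\<close>, above the fixed point
        \<open>1/2\<close>, so the falling thresholds eventually exclude it. The trees
        \<open>fork 1 2\<close> and \<open>graft (path_tree 1) (path_tree 1)\<close> have load
        exactly \<open>1/2\<close> and pass every threshold.\<close>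
      have "edge_load (1 / 4) (3 / 8) < ?z \<Longrightarrow> k \<le> 5"
        by (subst (asm) edge_load_less_iff) (simp_all add: field_simps)
      then have k: "k \<le> 5" if "i = 1 \<and> j = 3 \<or> i = 3 \<and> j = 1"
        using w that by (auto simp: load_path_values edge_load_commute simp del: chain.simps)
      \<comment> \<open>Two children with at least two edges each cost at least
        \<open>edge_load (1 / 3) (1 / 3) = 9/16\<close>, more than \<open>5/9\<close>.\<close>
      have "i = 1 \<or> j = 1"
        using w1 i(1) j(1) by (auto simp: load_path_values edge_load_def simp del: chain.simps)
      then consider "rooted_iso (Join a b c) (fork 1 1)" | "rooted_iso (Join a b c) (fork 1 2)"
        | "rooted_iso (Join a b c) (fork 1 3)" "k \<le> 5"
        using rooted_iso k i(1) j(1) by auto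
      then have "\<exists>x. rooted_iso (Join a b c) (chain 0 x) \<and> ?shape 0 x k"
      proof cases
        case 1
        then show ?thesis by (intro exI[of _ "fork 1 1"]) simp
      next
        case 2
        then show ?thesis by (intro exI[of _ "fork 1 2"]) simp
      next
        case 3
        then show ?thesis by (intro exI[of _ "fork 1 3"]) simp
      qed
      then show ?thesis by blast
    qed
  qed
qed

section \<open>Classification of the good tree shapes\<close>

text \<open>Each shape is rooted where the classification finds it, at an end of a path or at a
  branching. \<open>Suc k\<close> keeps a pendant path nonempty, whereas a chain between two
  branchings may have \<open>k = 0\<close>.\<close>

inductive small_shape :: "htree \<Rightarrow> bool" where
  A: "small_shape (path_tree (Suc k))"
| D: "small_shape (graft (graft (path_tree 1) (path_tree 1)) (path_tree (Suc k)))"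
| E: "k \<in> {2, 3, 4} \<Longrightarrow> small_shape (graft (graft (path_tree 1) (path_tree 2)) (path_tree k))"
| BD: "small_shape (graft (graft (path_tree 1) (path_tree 1)) (chain k (fork 1 1)))"
| D': "small_shape (Join (path_tree 1) (path_tree 1) (path_tree (Suc k)))"
| B: "small_shape (Join (path_tree 1) (path_tree 2) (path_tree (Suc k)))"
| F13: "k \<in> {3..13} \<Longrightarrow> small_shape (Join (path_tree 1) (path_tree 3) (path_tree k))"
| F14: "k \<in> {4..7} \<Longrightarrow> small_shape (Join (path_tree 1) (path_tree 4) (path_tree k))"
| F15: "small_shape (Join (path_tree 1) (path_tree 5) (path_tree 5))"
| F22: "k \<in> {2..6} \<Longrightarrow> small_shape (Join (path_tree 2) (path_tree 2) (path_tree k))"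
| F23: "small_shape (Join (path_tree 2) (path_tree 3) (path_tree 3))"
| G11: "small_shape (Join (path_tree 1) (path_tree 1) (chain k (fork 1 1)))"
| G12: "small_shape (Join (path_tree 1) (path_tree 1) (chain k (fork 1 2)))"
| G13: "k \<le> 5 \<Longrightarrow> small_shape (Join (path_tree 1) (path_tree 1) (chain k (fork 1 3)))"

section \<open>Reading a chain between two branchings from its other end\<close>

lemma unrooted_iso_Join: "rooted_iso a a' \<Longrightarrow> rooted_iso b b' \<Longrightarrow> rooted_iso c c' \<Longrightarrow> unrooted_iso (Join a b c) (Join a' b' c')"
  by (intro unrooted_iso_rooted_iso rooted_iso_cong)

lemma unrooted_iso_Join_chain: "unrooted_iso (Join p q (chain k t)) (graft t (chain k (Join Leaf p q)))"
proof -
  have "unrooted_iso (Join p q (chain k t)) (Join (chain k t) q p)" by (rule unrooted_iso_rot2)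
  also have "rooted_iso \<dots> (Join (chain k t) p q)" by (rule rooted_iso_swap)
  also have "\<dots> = graft (chain k t) (Join Leaf p q)" by simp
  also have "rooted_iso \<dots> (graft (Join Leaf p q) (chain k t))" by (rule graft_commute)
  also have "unrooted_iso \<dots> (graft t (chain k (Join Leaf p q)))" by (rule graft_chain_reverse)
  finally show ?thesis .
qed

text \<open>A chain between two branching edges may be entered from either side. The case analysis
  sorts branches by load and so may meet the heavier end first; this lemma restores the order used
  in \<open>small_shape\<close>.\<close>

lemma unrooted_iso_Join_chain_Join:
  "unrooted_iso (Join p q (chain k (Join Leaf p' q'))) (Join p' q' (chain k (Join Leaf p q)))"
proof -
  have "unrooted_iso (Join p q (chain k (Join Leaf p' q'))) (graft (Join Leaf p' q') (chain k (Join Leaf p q)))"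
    by (rule unrooted_iso_Join_chain)
  also have "rooted_iso \<dots> (graft (chain k (Join Leaf p q)) (Join Leaf p' q'))" by (rule graft_commute)
  also have "\<dots> = Join (chain k (Join Leaf p q)) p' q'" by simp
  also have "unrooted_iso \<dots> (Join q' p' (chain k (Join Leaf p q)))" by (rule unrooted_iso_rot2)
  also have "unrooted_iso \<dots> (Join p' q' (chain k (Join Leaf p q)))" by (rule unrooted_iso_rot)
  finally show ?thesis .
qed

section \<open>The two branching cases: a vertex of degree three, an edge branching at every
  vertex\<close>

lemma rooted_iso_comm12: "rooted_iso (Join (Join (Join r b c) d e) f g) (Join (Join (Join r d e) b c) f g)"
  by (intro rooted_iso_cong rooted_iso_comm rooted_iso_refl)

text \<open>The edges at the root share a budget of \<open>1\<close> and each takes at least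
  \<open>1/4\<close>. So there is no fourth edge, the cheapest takes less than \<open>1/3\<close>
  and is pendant, and the second takes less than half of the remaining \<open>3/4\<close>, which
  admits only one or two edges in its branch. The third branch then has to fit into what is
  left.\<close>

lemma small_shape_star_sorted:
  assumes g: "good (Join (Join (Join r b c) d e) f h)"
    and le: "edge_load (load b) (load c) \<le> edge_load (load d) (load e)"
      "edge_load (load d) (load e) \<le> edge_load (load f) (load h)"
  shows "\<exists>s. unrooted_iso (Join (Join (Join r b c) d e) f h) s \<and> small_shape s"
proof -
  have gs: "good r" "good b" "good c" "good d" "good e" "good f" "good h" using g by auto
  have l: "load r + edge_load (load b) (load c) + edge_load (load d) (load e)
      + edge_load (load f) (load h) < 1" using g by simp
  note ge = edge_load_ge[OF gs(2,3)] edge_load_ge[OF gs(4,5)] edge_load_ge[OF gs(6,7)]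
    good_load_nonneg[OF gs(1)]
  have r: "r = Leaf" using l ge by (intro load_less_quarter gs) linarith
  have "edge_load (load b) (load c) < 1 / 3" using l le ge by linarith
  then have bc: "b = Leaf" "c = Leaf" using edge_load_less_third gs by blast+
  have e2: "edge_load (load d) (load e) < 3 / 8" using l le ge by linarith
  have fh: "edge_load (load f) (load h) + edge_load (load d) (load e) < 3 / 4"
    using l ge by linarith
  have fork_good: "good (Join Leaf f h)" using gs l ge by simp
  have fork_load: "load (Join Leaf f h) = edge_load (load f) (load h)" by simp
  have t: "Join (Join (Join r b c) d e) f h = graft (Join (path_tree 1) d e) (Join Leaf f h)"
    by (simp add: r bc)
  have subst: "unrooted_iso (Join (Join (Join r b c) d e) f h) (graft a p)"
    if "rooted_iso (Join (path_tree 1) d e) a" "rooted_iso (Join Leaf f h) p" for a p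
    unfolding t using that by (meson graft_rooted_iso graft_rooted_iso2 rooted_iso_trans unrooted_iso_rooted_iso)
  have "d = Leaf \<or> e = Leaf"
  proof (rule ccontr)
    assume nl: "\<not> (d = Leaf \<or> e = Leaf)"
    \<comment> \<open>The left-hand side is \<open>4/9\<close>, more than the available
      \<open>3/8\<close>.\<close>
    have "edge_load (1 / 4) (1 / 4) \<le> edge_load (load d) (load e)"
      using nl load_ge_quarter gs good_load_less by (intro edge_load_mono) auto
    then show False using e2 by (simp add: edge_load_def)
  qed
  then consider "d = Leaf" "e = Leaf" | x where "x \<noteq> Leaf" "{d, e} = {Leaf, x}" by blast
  then show ?thesis
  proof cases
    case 1
    \<comment> \<open>The remainder \<open>3/4 - 1/4\<close> is exactly the fixed point, so the
      third branch may be arbitrarily long.\<close>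
    have "load (Join Leaf f h) < 1 / 2"
      using fh 1 unfolding fork_load by (simp add: edge_load_def)
    then consider k where "rooted_iso (Join Leaf f h) (path_tree k)" | k where "rooted_iso (Join Leaf f h) (chain k (fork 1 1))"
      using load_less_half[OF fork_good] by blast
    moreover have "rooted_iso (Join (path_tree 1) d e) (graft (path_tree 1) (path_tree 1))" using 1 by simp
    ultimately show ?thesis
    proof cases
      case (1 k)
      then obtain j where "k = Suc j" using rooted_iso_Leaf[OF 1] by (cases k) auto
      then show ?thesis
        using subst 1 \<open>rooted_iso (Join (path_tree 1) d e) (graft (path_tree 1) (path_tree 1))\<close> small_shape.D by metis
    next
      case (2 k)
      then show ?thesis
        using subst \<open>rooted_iso (Join (path_tree 1) d e) (graft (path_tree 1) (path_tree 1))\<close> small_shape.BD by metis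
    qed
  next
    case (2 x)
    have x: "good x" and de: "edge_load (load d) (load e) = edge_load 0 (load x)"
      and sw: "rooted_iso (Join (path_tree 1) d e) (Join (path_tree 1) Leaf x)"
      using 2 gs by (auto simp: doubleton_eq_iff edge_load_commute rooted_iso_swap)
    have "load x < 1 / 3"
      using e2 de edge_load_less_iff[of 0 "load x" "3/8"] good_load_less[OF x] by simp
    then have x1: "x = path_tree 1" using load_less_third x 2(1) by blast
    then have req1: "rooted_iso (Join (path_tree 1) d e) (graft (path_tree 1) (path_tree 2))"
      using sw by (simp add: numeral_2_eq_2)
    have de3: "edge_load (load d) (load e) = 1 / 3"
      unfolding de x1 load_path_values by (simp add: edge_load_def)
    \<comment> \<open>The upper bound \<open>3/4 - 1/3 = 5/12\<close> is the load of a path with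
      \<open>5\<close> edges; the lower bound comes from the sorting and is the load of a path with
      \<open>2\<close> edges.\<close>
    have fl: "load (Join Leaf f h) < 5 / 12" "1 / 3 \<le> load (Join Leaf f h)"
      using fh le de3 unfolding fork_load by linarith+
    obtain k where k: "rooted_iso (Join Leaf f h) (path_tree k)"
      using load_less_four_ninths[OF fork_good] fl by auto
    have "load (path_tree k) < 5 / 12" "\<not> load (path_tree k) < 1 / 3" using fl load_rooted_iso[OF k] by auto
    then have "real k < 5" "\<not> real k < 2" unfolding load_path_less_iff by auto
    then have "k \<in> {2, 3, 4}" by auto
    then show ?thesis using subst[OF req1 k] small_shape.E by blast
  qed
qed

text \<open>The order of the edges at the root is immaterial up to \<open>rooted_iso\<close>, so
  they may be sorted by their demands; goodness is carried along each permutation.\<close>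

lemma small_shape_star:
  assumes g: "good (Join (Join (Join r b c) d e) f h)"
  shows "\<exists>s. unrooted_iso (Join (Join (Join r b c) d e) f h) s \<and> small_shape s"
proof -
  have swap1: "rooted_iso (Join (Join (Join r b c) d e) f h) (Join (Join (Join r d e) b c) f h)"
    and swap2: "rooted_iso (Join (Join (Join r b c) d e) f h) (Join (Join (Join r b c) f h) d e)"
    for b c d e f h
    by (rule rooted_iso_comm12, rule rooted_iso_comm)
  let ?goal = "\<lambda>b c d e f h. \<exists>s. unrooted_iso (Join (Join (Join r b c) d e) f h) s \<and> small_shape s"
  have goal1: "?goal b c d e f h" if "?goal d e b c f h" for b c d e f h
    using that swap1 rooted_iso_unrooted_iso_trans by blast
  have goal2: "?goal b c d e f h" if "?goal b c f h d e" for b c d e f h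
    using that swap2 rooted_iso_unrooted_iso_trans by blast
  have good1: "good (Join (Join (Join r b c) f h) d e)" by (rule iffD1[OF good_rooted_iso[OF swap2] g])
  have good2: "good (Join (Join (Join r d e) b c) f h)" by (rule iffD1[OF good_rooted_iso[OF swap1] g])
  have good3: "good (Join (Join (Join r d e) f h) b c)" by (rule iffD1[OF good_rooted_iso[OF swap2] good2])
  have good4: "good (Join (Join (Join r f h) b c) d e)" by (rule iffD1[OF good_rooted_iso[OF swap1] good1])
  have good5: "good (Join (Join (Join r f h) d e) b c)" by (rule iffD1[OF good_rooted_iso[OF swap1] good3])
  let ?x = "edge_load (load b) (load c)" and ?y = "edge_load (load d) (load e)"
    and ?z = "edge_load (load f) (load h)"
  consider "?x \<le> ?y" "?y \<le> ?z" | "?x \<le> ?z" "?z \<le> ?y" | "?y \<le> ?x" "?x \<le> ?z"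
    | "?y \<le> ?z" "?z \<le> ?x" | "?z \<le> ?x" "?x \<le> ?y" | "?z \<le> ?y" "?y \<le> ?x" by linarith
  then show ?thesis
  proof cases
    case 1
    then show ?thesis using small_shape_star_sorted[OF g] by simp
  next
    case 2
    then have "?goal b c f h d e" using small_shape_star_sorted[OF good1] by simp
    then show ?thesis by (rule goal2)
  next
    case 3
    then have "?goal d e b c f h" using small_shape_star_sorted[OF good2] by simp
    then show ?thesis by (rule goal1)
  next
    case 4
    then have "?goal d e f h b c" using small_shape_star_sorted[OF good3] by simp
    then show ?thesis by (rule goal1[OF goal2])
  next
    case 5
    then have "?goal f h b c d e" using small_shape_star_sorted[OF good4] by simp
    then show ?thesis by (rule goal2[OF goal1])
  next
    case 6
    then have "?goal f h d e b c" using small_shape_star_sorted[OF good5] by simp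
    then have "?goal d e f h b c" by (rule goal1)
    then have "?goal d e b c f h" by (rule goal2)
    then show ?thesis by (rule goal1)
  qed
qed

text \<open>The three residuals have product above \<open>1/4\<close>, which keeps the two lighter
  branches so far below \<open>1/2\<close> that they are short paths. For each remaining pair of
  lengths the heaviest branch has load below
  \<open>1 - 1 / (4 * (1 - load p) * (1 - load q))\<close>.\<close>

lemma small_shape_three_sorted:
  assumes g: "good (Join p q r)" and nl: "p \<noteq> Leaf" "q \<noteq> Leaf" "r \<noteq> Leaf"
    and le: "load p \<le> load q" "load q \<le> load r"
  shows "\<exists>s. unrooted_iso (Join p q r) s \<and> small_shape s"
proof -
  have gs: "good p" "good q" "good r" using g by auto
  let ?p = "1 - load p" and ?q = "1 - load q" and ?r = "1 - load r"
  have prod: "1 / 4 < ?p * ?q * ?r" using g unfolding good_Join_iff by simp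
  note bounds = good_bounds[OF gs(1)] good_bounds[OF gs(2)] good_bounds[OF gs(3)]
  note quarter = load_ge_quarter[OF gs(1) nl(1)] load_ge_quarter[OF gs(2) nl(2)] load_ge_quarter[OF gs(3) nl(3)]
  \<comment> \<open>The cube of \<open>5/8\<close> is \<open>125/512\<close>, just below
    \<open>1/4\<close>; and \<open>3/8\<close> is the load of a path with \<open>3\<close>
    edges.\<close>
  have p: "load p < 3 / 8"
  proof (rule ccontr)
    assume "\<not> ?thesis"
    then have "?p * ?q * ?r \<le> 5 / 8 * (5 / 8) * (5 / 8)"
      using bounds le by (intro mult_mono mult_nonneg_nonneg) auto
    then show False using prod by simp
  qed
  \<comment> \<open>Here \<open>3/4 * (4/7) * (4/7) = 12/49\<close> is just below
    \<open>1/4\<close>, and \<open>3/7\<close> is the load of a path with \<open>6\<close>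
    edges.\<close>
  have q: "load q < 3 / 7"
  proof (rule ccontr)
    assume "\<not> ?thesis"
    then have "?p * ?q * ?r \<le> 3 / 4 * (4 / 7) * (4 / 7)"
      using bounds le quarter by (intro mult_mono mult_nonneg_nonneg) auto
    then show False using prod by simp
  qed
  obtain i where i: "rooted_iso p (path_tree i)" using load_less_four_ninths gs p by force
  obtain j where j: "rooted_iso q (path_tree j)" using load_less_four_ninths gs q by force
  have ij0: "i \<noteq> 0" "j \<noteq> 0" using rooted_iso_Leaf i j nl by (metis chain.simps(1))+
  have "real i < 3" using p load_rooted_iso[OF i] load_path_less_iff[of i "3/8"] by simp
  then have i12: "i = 1 \<or> i = 2" using ij0 by linarith
  have "real j < 6" using q load_rooted_iso[OF j] load_path_less_iff[of j "3/7"] by simp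
  then have j15: "j = 1 \<or> j = 2 \<or> j = 3 \<or> j = 4 \<or> j = 5" using ij0 by linarith
  have ld: "load p = load (path_tree i)" "load q = load (path_tree j)" using load_rooted_iso i j by auto
  have le': "load (path_tree i) \<le> load (path_tree j)" "load (path_tree j) \<le> load r" using le ld by auto
  have unrooted_iso: "unrooted_iso (Join p q r) (Join (path_tree i) (path_tree j) s)" if "rooted_iso r s" for s
    using i j that unrooted_iso_Join by blast
  have prod': "1 / 4 < (1 - load (path_tree i)) * (1 - load (path_tree j)) * ?r" using prod ld by simp
  have short: "\<exists>k. unrooted_iso (Join p q r) (Join (path_tree i) (path_tree j) (path_tree k)) \<and>
      load (path_tree j) \<le> load (path_tree k) \<and> load (path_tree k) < z" if "load r < z" "z \<le> 4 / 9" for z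
  proof -
    obtain k where k: "rooted_iso r (path_tree k)" using load_less_four_ninths[OF gs(3)] \<open>load r < z\<close> \<open>z \<le> 4/9\<close> by auto
    then show ?thesis using unrooted_iso[OF k] load_rooted_iso[OF k] le' \<open>load r < z\<close> by auto
  qed
  consider "i = 1" "j = 1" | "i = 1" "j = 2" | "i = 1" "j = 3" | "i = 1" "j = 4" | "i = 1" "j = 5"
    | "i = 2" "j = 2" | "i = 2" "j = 3" | "i = 2" "j = 4" | "i = 2" "j = 5"
    using i12 j15 le' by (auto simp: load_path_values simp del: chain.simps)
  then show ?thesis
  proof cases
    case 1
    \<comment> \<open>Two pendant edges leave \<open>1 - 4/9 = 5/9\<close>, the threshold of
      \<open>load_less_five_ninths\<close> for \<open>k = 0\<close>.\<close>
    have "load r < (real 0 + 10) / (2 * (real 0 + 9))"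
      using prod' unfolding 1 load_path_values by simp
    then obtain n b where nb: "rooted_iso r (chain n b)"
      "b \<in> {Leaf, graft (path_tree 1) (path_tree 1), fork 1 1, fork 1 2} \<or> b = fork 1 3 \<and> n + 0 \<le> 5"
      using load_less_five_ninths[OF gs(3)] by blast
    have u: "unrooted_iso (Join p q r) (Join (path_tree 1) (path_tree 1) (chain n b))" using unrooted_iso[OF nb(1)] 1 by simp
    from nb(2) consider "b = Leaf" | "b = graft (path_tree 1) (path_tree 1)" | "b = fork 1 1" | "b = fork 1 2"
      | "b = fork 1 3" "n \<le> 5" by auto
    then show ?thesis
    proof cases
      case 1
      then obtain m where "n = Suc m" using nb(1) rooted_iso_Leaf nl(3) by (cases n) auto
      then show ?thesis using u 1 small_shape.D' by blast
    next
      case 2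
      then have "unrooted_iso (Join p q r) (graft (graft (path_tree 1) (path_tree 1)) (chain n (fork 1 1)))"
        using u unrooted_iso_Join_chain unrooted_iso_trans by blast
      then show ?thesis using small_shape.BD by blast
    qed (use u small_shape.G11 small_shape.G12 small_shape.G13 in blast)+
  next
    case 2
    \<comment> \<open>The residuals \<open>3/4\<close> and \<open>2/3\<close> multiply to
      \<open>1/2\<close>, which leaves exactly the fixed point.\<close>
    have "load r < 1 / 2" using prod' unfolding 2 load_path_values by simp
    then consider k where "rooted_iso r (path_tree k)" | k where "rooted_iso r (chain k (fork 1 1))"
      using load_less_half[OF gs(3)] by blast
    then show ?thesis
    proof cases
      case (1 k)
      then obtain m where "k = Suc m" using rooted_iso_Leaf nl(3) by (cases k) auto
      then show ?thesis using unrooted_iso[OF 1] small_shape.B 2 by metis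
    next
      case k: (2 k)
      then have "unrooted_iso (Join p q r) (Join (path_tree 1) (path_tree 1) (chain k (fork 1 2)))"
        using unrooted_iso[OF k] unrooted_iso_Join_chain_Join unrooted_iso_trans unfolding 2 by blast
      then show ?thesis using small_shape.G12 by blast
    qed
  next
    case 3
    \<comment> \<open>\<open>7/15\<close> is the load of a path with \<open>14\<close> edges. A
      chain ending in \<open>fork 1 1\<close> counts as \<open>8\<close> additional edges, which
      gives the bound \<open>5\<close> on its length.\<close>
    have r: "load r < 7 / 15" using prod' unfolding 3 load_path_values by simp
    then consider k where "rooted_iso r (path_tree k)" | k where "rooted_iso r (chain k (fork 1 1))"
      using load_less_half[OF gs(3)] by auto
    then show ?thesis
    proof cases
      case (1 k)
      have "load (path_tree k) < 7 / 15" "\<not> load (path_tree k) < 3 / 8"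
        using r load_rooted_iso[OF 1] le' unfolding 3 load_path_values by auto
      then have "real k < 14" "\<not> real k < 3" unfolding load_path_less_iff by auto
      then have "k \<in> {3..13}" by auto
      then show ?thesis using unrooted_iso[OF 1] small_shape.F13 3 by metis
    next
      case k: (2 k)
      then have "unrooted_iso (Join p q r) (Join (path_tree 1) (path_tree 1) (chain k (fork 1 3)))"
        using unrooted_iso[OF k] unrooted_iso_Join_chain_Join unrooted_iso_trans unfolding 3 by blast
      moreover have "(real k + 8) / (2 * (real k + 9)) < 7 / 15"
        using r load_rooted_iso[OF k] load_chain_fork[of k] by simp
      then have "real k < 6" by (simp add: field_simps)
      then have "k \<le> 5" by simp
      ultimately show ?thesis using small_shape.G13 by blast
    qed
  next
    case 4
    \<comment> \<open>The bounds \<open>4/9\<close>, \<open>3/7\<close>, \<open>7/16\<close> and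
      \<open>2/5\<close> of this and the next three cases are the loads of paths with
      \<open>8\<close>, \<open>6\<close>, \<open>7\<close> and \<open>4\<close> edges. The lower
      bounds on \<open>k\<close> come from the sorting.\<close>
    have "load r < 4 / 9" using prod' unfolding 4 load_path_values by simp
    then obtain k where k: "unrooted_iso (Join p q r) (Join (path_tree 1) (path_tree 4) (path_tree k))"
      "load (path_tree k) < 4 / 9" "\<not> load (path_tree k) < 2 / 5"
      using short[of "4 / 9"] unfolding 4 load_path_values by auto
    then have "real k < 8" "\<not> real k < 4" unfolding load_path_less_iff by auto
    then have "k \<in> {4..7}" by auto
    then show ?thesis using k(1) small_shape.F14 by blast
  next
    case 5
    have "load r < 3 / 7" using prod' unfolding 5 load_path_values by simp
    then obtain k where k: "unrooted_iso (Join p q r) (Join (path_tree 1) (path_tree 5) (path_tree k))"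
      "load (path_tree k) < 3 / 7" "\<not> load (path_tree k) < 5 / 12"
      using short[of "3 / 7"] unfolding 5 load_path_values by auto
    then have "real k < 6" "\<not> real k < 5" unfolding load_path_less_iff by auto
    then have "k = 5" by auto
    then show ?thesis using k(1) small_shape.F15 by blast
  next
    case 6
    have "load r < 7 / 16" using prod' unfolding 6 load_path_values by simp
    then obtain k where k: "unrooted_iso (Join p q r) (Join (path_tree 2) (path_tree 2) (path_tree k))"
      "load (path_tree k) < 7 / 16" "\<not> load (path_tree k) < 1 / 3"
      using short[of "7 / 16"] unfolding 6 load_path_values by auto
    then have "real k < 7" "\<not> real k < 2" unfolding load_path_less_iff by auto
    then have "k \<in> {2..6}" by auto
    then show ?thesis using k(1) small_shape.F22 by blast
  next
    case 7
    have "load r < 2 / 5" using prod' unfolding 7 load_path_values by simp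
    then obtain k where k: "unrooted_iso (Join p q r) (Join (path_tree 2) (path_tree 3) (path_tree k))"
      "load (path_tree k) < 2 / 5" "\<not> load (path_tree k) < 3 / 8"
      using short[of "2 / 5"] unfolding 7 load_path_values by auto
    then have "real k < 4" "\<not> real k < 3" unfolding load_path_less_iff by auto
    then have "k = 3" by auto
    then show ?thesis using k(1) small_shape.F23 by blast
  next
    case 8
    \<comment> \<open>The heaviest branch would be lighter than the second one, here and in the next
      case.\<close>
    have "load r < 3 / 8" using prod' unfolding 8 load_path_values by simp
    then show ?thesis using le' unfolding 8 load_path_values by simp
  next
    case 9
    have "load r < 5 / 14" using prod' unfolding 9 load_path_values by simp
    then show ?thesis using le' unfolding 9 load_path_values by simp
  qed
qed

lemma small_shape_three:
  assumes g: "good (Join p q r)" and nl: "p \<noteq> Leaf" "q \<noteq> Leaf" "r \<noteq> Leaf"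
  shows "\<exists>s. unrooted_iso (Join p q r) s \<and> small_shape s"
proof -
  have perms: "unrooted_iso (Join p q r) (Join p r q)" "unrooted_iso (Join p q r) (Join q p r)" "unrooted_iso (Join p q r) (Join r q p)"
    "unrooted_iso (Join p q r) (Join q r p)" "unrooted_iso (Join p q r) (Join r p q)"
    by (rule unrooted_iso_rooted_iso[OF rooted_iso_swap], rule unrooted_iso_rot, rule unrooted_iso_rot2,
        rule unrooted_iso_trans[OF unrooted_iso_rot unrooted_iso_rooted_iso[OF rooted_iso_swap]], rule unrooted_iso_trans[OF unrooted_iso_rot2 unrooted_iso_rooted_iso[OF rooted_iso_swap]])
  have sorted: "\<exists>s. unrooted_iso (Join p q r) s \<and> small_shape s"
    if "unrooted_iso (Join p q r) (Join a b c)" "load a \<le> load b" "load b \<le> load c" "{a, b, c} = {p, q, r}" for a b c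
  proof -
    have "\<forall>x\<in>{a, b, c}. x \<noteq> Leaf" unfolding that(4) using nl by simp
    then have "a \<noteq> Leaf" "b \<noteq> Leaf" "c \<noteq> Leaf" by simp_all
    then show ?thesis
      using small_shape_three_sorted[of a b c] that(1-3) good_unrooted_iso[OF that(1)] g unrooted_iso_trans by blast
  qed
  consider "load p \<le> load q" "load q \<le> load r" | "load p \<le> load r" "load r \<le> load q"
    | "load q \<le> load p" "load p \<le> load r" | "load q \<le> load r" "load r \<le> load p"
    | "load r \<le> load p" "load p \<le> load q" | "load r \<le> load q" "load q \<le> load p" by linarith
  then show ?thesis
  proof cases
    case 1
    then show ?thesis by (rule sorted[OF unrooted_iso_refl]) simp
  next
    case 2
    then show ?thesis by (rule sorted[OF perms(1)]) auto
  next
    case 3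
    then show ?thesis by (rule sorted[OF perms(2)]) auto
  next
    case 4
    then show ?thesis by (rule sorted[OF perms(4)]) auto
  next
    case 5
    then show ?thesis by (rule sorted[OF perms(5)]) auto
  next
    case 6
    then show ?thesis by (rule sorted[OF perms(3)]) auto
  qed
qed

theorem good_imp_small_shape:
  assumes "good t" "t \<noteq> Leaf"
  shows "\<exists>s. unrooted_iso t s \<and> small_shape s"
proof -
  consider k where "unrooted_iso t (path_tree k)" | t' where "unrooted_iso t t'" "branched t'"
    using unrooted_path_or_branched by blast
  then show ?thesis
  proof cases
    case (1 k)
    have "unrooted_iso a b \<Longrightarrow> a = Leaf \<longleftrightarrow> b = Leaf" for a b
      by (induction rule: unrooted_iso.induct) (auto simp: rooted_iso_Leaf)
    then have "path_tree k \<noteq> Leaf" using 1 assms(2) by blast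
    then obtain m where "k = Suc m" by (cases k) auto
    then show ?thesis using 1 small_shape.A by blast
  next
    case (2 t')
    then have "good t'" using assms good_unrooted_iso by blast
    then have "\<exists>s. unrooted_iso t' s \<and> small_shape s"
      using 2(2) small_shape_star small_shape_three unfolding branched_def by blast
    then show ?thesis using 2(1) unrooted_iso_trans by blast
  qed
qed

section \<open>Hypertrees\<close>

text \<open>Disjoint vertex sets encode acyclicity, and they make \<open>v\<close>,
  \<open>s\<close>, \<open>t\<close> distinct because every root lies in its own vertex set. The
  vertex set is a separate argument since a leaf has a vertex but no edge to cover it.\<close>

inductive hypertree :: "'a set set \<Rightarrow> 'a set \<Rightarrow> 'a \<Rightarrow> htree \<Rightarrow> bool" where
  hypertree_Leaf: "hypertree {} {v} v Leaf"
| hypertree_Join: "\<lbrakk>hypertree E1 V1 v a; hypertree E2 V2 s b; hypertree E3 V3 t c;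
     V1 \<inter> V2 = {}; V1 \<inter> V3 = {}; V2 \<inter> V3 = {}\<rbrakk>
    \<Longrightarrow> hypertree (insert {v, s, t} (E1 \<union> E2 \<union> E3)) (V1 \<union> V2 \<union> V3) v (Join a b c)"

inductive_cases hypertree_JoinE: "hypertree E V v (Join a b c)"

lemma hypertree_JoinI:
  assumes "hypertree E1 V1 v a" "hypertree E2 V2 s b" "hypertree E3 V3 t c"
    and "V1 \<inter> V2 = {}" "V1 \<inter> V3 = {}" "V2 \<inter> V3 = {}"
    and "E = insert {v, s, t} (E1 \<union> E2 \<union> E3)" "V = V1 \<union> V2 \<union> V3"
  shows "hypertree E V v (Join a b c)"
  using hypertree_Join[OF assms(1-6)] assms(7,8) by simp

lemma hypertree_root: "hypertree E V v t \<Longrightarrow> v \<in> V"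
  by (induction rule: hypertree.induct) auto

lemma hypertree_finite: "hypertree E V v t \<Longrightarrow> finite E \<and> finite V"
  by (induction rule: hypertree.induct) auto

lemma hypertree_edge_subset: "hypertree E V v t \<Longrightarrow> e \<in> E \<Longrightarrow> e \<subseteq> V \<and> e \<noteq> {}"
  by (induction rule: hypertree.induct) (auto dest: hypertree_root)

lemma hypertree_edges_disjoint:
  assumes "hypertree E V v t" "hypertree E' V' v' t'" "V \<inter> V' = {}"
  shows "E \<inter> E' = {}"
proof -
  have False if e: "e \<in> E" "e \<in> E'" for e
  proof -
    have "e \<subseteq> V \<inter> V'" "e \<noteq> {}"
      using hypertree_edge_subset[OF assms(1) e(1)] hypertree_edge_subset[OF assms(2) e(2)] by auto
    then show False using assms(3) by simp
  qed
  then show ?thesis by auto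
qed

lemma hypertree_new_edge:
  assumes "hypertree E V v t" "\<not> e \<subseteq> V"
  shows "e \<notin> E"
  using assms hypertree_edge_subset[OF assms(1), of e] by blast

lemma hypertree_isomorphic:
  assumes "hypertree E V v t" "hypertree E' V' v' t"
  shows "\<exists>f. bij_betw f V V' \<and> f v = v' \<and> (\<lambda>e. f ` e) ` E = E'"
  using assms
proof (induction arbitrary: E' V' v' rule: hypertree.induct)
  case (hypertree_Leaf v)
  then have "E' = {}" "V' = {v'}" by (auto elim: hypertree.cases)
  then show ?case by (intro exI[of _ "\<lambda>_. v'"]) (auto simp: bij_betw_def)
next
  case (hypertree_Join E1 V1 v a E2 V2 s b E3 V3 t c)
  note hyps = hypertree_Join.hyps and IH = hypertree_Join.IH
  from hypertree_Join.prems obtain E1' V1' E2' V2' s' E3' V3' t'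
    where E': "E' = insert {v', s', t'} (E1' \<union> E2' \<union> E3')" and V': "V' = V1' \<union> V2' \<union> V3'"
      and h: "hypertree E1' V1' v' a" "hypertree E2' V2' s' b" "hypertree E3' V3' t' c"
      and d: "V1' \<inter> V2' = {}" "V1' \<inter> V3' = {}" "V2' \<inter> V3' = {}"
    by (rule hypertree_JoinE)
  obtain f1 f2 f3 where
    f1: "bij_betw f1 V1 V1'" "f1 v = v'" "(\<lambda>e. f1 ` e) ` E1 = E1'" and
    f2: "bij_betw f2 V2 V2'" "f2 s = s'" "(\<lambda>e. f2 ` e) ` E2 = E2'" and
    f3: "bij_betw f3 V3 V3'" "f3 t = t'" "(\<lambda>e. f3 ` e) ` E3 = E3'"
    using IH(1)[OF h(1)] IH(2)[OF h(2)] IH(3)[OF h(3)] by blast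
  define f where "f u = (if u \<in> V1 then f1 u else if u \<in> V2 then f2 u else f3 u)" for u
  have "bij_betw f (V1 \<union> (V2 \<union> V3)) (V1' \<union> (V2' \<union> V3'))"
    unfolding f_def using hyps d
    by (intro bij_betw_disjoint_Un f1 f2 f3) auto
  then have bij: "bij_betw f (V1 \<union> V2 \<union> V3) V'" by (simp add: V' Un_assoc)
  have eq: "f u = f1 u" if "u \<in> V1" for u using that by (simp add: f_def)
  have eq2: "f u = f2 u" if "u \<in> V2" for u using that hyps by (auto simp: f_def)
  have eq3: "f u = f3 u" if "u \<in> V3" for u using that hyps by (auto simp: f_def)
  have im: "(\<lambda>e. f ` e) ` F = (\<lambda>e. g ` e) ` F"
    if "hypertree F U w x" "\<And>u. u \<in> U \<Longrightarrow> f u = g u" for F U w x and g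
    using that hypertree_edge_subset[OF that(1)] by (intro image_cong refl) auto
  have "(\<lambda>e. f ` e) ` E1 = E1'" "(\<lambda>e. f ` e) ` E2 = E2'" "(\<lambda>e. f ` e) ` E3 = E3'"
    using im[OF hyps(1), of f1] im[OF hyps(2), of f2] im[OF hyps(3), of f3] eq eq2 eq3 f1(3) f2(3) f3(3)
    by simp_all
  moreover have "f ` {v, s, t} = {v', s', t'}"
    using eq[of v] eq2[of s] eq3[of t] hyps(1-3)[THEN hypertree_root] f1(2) f2(2) f3(2) by simp
  ultimately have img: "(\<lambda>e. f ` e) ` (insert {v, s, t} (E1 \<union> E2 \<union> E3)) = E'"
    by (simp only: image_insert image_Un E')
  have "f v = v'" using eq[OF hypertree_root[OF hyps(1)]] f1(2) by simp
  then show ?case using bij img by blast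
qed

lemma hypertree_rooted_iso: "rooted_iso t t' \<Longrightarrow> hypertree E V v t \<Longrightarrow> hypertree E V v t'"
proof (induction arbitrary: E V v rule: rooted_iso.induct)
  case (rooted_iso_cong a a' b b' c c')
  from rooted_iso_cong.prems show ?case
    by (elim hypertree_JoinE) (hypsubst, intro hypertree_Join rooted_iso_cong.IH, assumption+)
next
  case (rooted_iso_swap a b c)
  then show ?case
    by (elim hypertree_JoinE) (auto intro!: hypertree_JoinI)
next
  case (rooted_iso_comm a b c d e)
  then obtain E1 V1 E2 V2 s2 E3 V3 s3 E4 V4 s4 E5 V5 s5 where
    h: "hypertree E1 V1 v a" "hypertree E2 V2 s2 b" "hypertree E3 V3 s3 c"
      "hypertree E4 V4 s4 d" "hypertree E5 V5 s5 e"
    and E: "E = insert {v, s4, s5} (insert {v, s2, s3} (E1 \<union> E2 \<union> E3) \<union> E4 \<union> E5)"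
    and V: "V = V1 \<union> V2 \<union> V3 \<union> V4 \<union> V5"
    and d: "V1 \<inter> V2 = {}" "V1 \<inter> V3 = {}" "V2 \<inter> V3 = {}" "(V1 \<union> V2 \<union> V3) \<inter> V4 = {}"
      "(V1 \<union> V2 \<union> V3) \<inter> V5 = {}" "V4 \<inter> V5 = {}"
    by (elim hypertree_JoinE) blast
  have "hypertree (insert {v, s4, s5} (E1 \<union> E4 \<union> E5)) (V1 \<union> V4 \<union> V5) v (Join a d e)"
    using d by (intro hypertree_Join h) auto
  then show ?case
    by (rule hypertree_JoinI[OF _ h(2,3)]) (use d E V in auto)
qed auto

lemma hypertree_unrooted_iso: "unrooted_iso t t' \<Longrightarrow> hypertree E V v t \<Longrightarrow> \<exists>v'. hypertree E V v' t'"
proof (induction arbitrary: v rule: unrooted_iso.induct)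
  case (unrooted_iso_rooted_iso a b)
  then show ?case by (intro exI[of _ v] hypertree_rooted_iso[OF unrooted_iso_rooted_iso.hyps])
next
  case (unrooted_iso_rot a b c)
  from unrooted_iso_rot obtain E1 V1 E2 V2 s E3 V3 t
    where "E = insert {v, s, t} (E1 \<union> E2 \<union> E3)" "V = V1 \<union> V2 \<union> V3"
      and h: "hypertree E1 V1 v a" "hypertree E2 V2 s b" "hypertree E3 V3 t c"
      and d: "V1 \<inter> V2 = {}" "V1 \<inter> V3 = {}" "V2 \<inter> V3 = {}"
    by (rule hypertree_JoinE)
  then have "hypertree E V s (Join b a c)"
    by (intro hypertree_JoinI[OF h(2) h(1) h(3)]) auto
  then show ?case ..
qed blast

lemma hypertree_attach_edge:
  assumes "hypertree E V v t" "u \<in> V" "x \<notin> V" "y \<notin> V" "x \<noteq> y"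
  shows "\<exists>t'. hypertree (insert {u, x, y} E) (V \<union> {x, y}) v t'"
  using assms
proof (induction rule: hypertree.induct)
  case (hypertree_Leaf v)
  then have "hypertree (insert {u, x, y} {}) ({v} \<union> {x, y}) v (Join Leaf Leaf Leaf)"
    by (intro hypertree_JoinI[OF hypertree.intros(1) hypertree.intros(1) hypertree.intros(1)]) auto
  then show ?case by blast
next
  case (hypertree_Join E1 V1 v a E2 V2 s b E3 V3 t c)
  note hyps = hypertree_Join.hyps
  from hypertree_Join.prems(1) consider "u \<in> V1" | "u \<in> V2" | "u \<in> V3" by blast
  then show ?case
  proof cases
    case 1
    then obtain a' where "hypertree (insert {u, x, y} E1) (V1 \<union> {x, y}) v a'"
      using hypertree_Join by blast
    then have "hypertree (insert {u, x, y} (insert {v, s, t} (E1 \<union> E2 \<union> E3))) (V1 \<union> V2 \<union> V3 \<union> {x, y}) v (Join a' b c)"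
      by (rule hypertree_JoinI[OF _ hyps(2,3)]) (use hypertree_Join.prems hyps in auto)
    then show ?thesis ..
  next
    case 2
    then obtain b' where "hypertree (insert {u, x, y} E2) (V2 \<union> {x, y}) s b'"
      using hypertree_Join by blast
    then have "hypertree (insert {u, x, y} (insert {v, s, t} (E1 \<union> E2 \<union> E3))) (V1 \<union> V2 \<union> V3 \<union> {x, y}) v (Join a b' c)"
      by (rule hypertree_JoinI[OF hyps(1) _ hyps(3)]) (use hypertree_Join.prems hyps in auto)
    then show ?thesis ..
  next
    case 3
    then obtain c' where "hypertree (insert {u, x, y} E3) (V3 \<union> {x, y}) t c'"
      using hypertree_Join by blast
    then have "hypertree (insert {u, x, y} (insert {v, s, t} (E1 \<union> E2 \<union> E3))) (V1 \<union> V2 \<union> V3 \<union> {x, y}) v (Join a b c')"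
      by (rule hypertree_JoinI[OF hyps(1,2)]) (use hypertree_Join.prems hyps in auto)
    then show ?thesis ..
  qed
qed

text \<open>Every edge contributes two new vertices. This is equality in
  \<open>subcritical_sparse\<close>, so a hypertree leaves no room for an edge that would close a
  cycle.\<close>

lemma hypertree_card: "hypertree E V v t \<Longrightarrow> card V = 2 * card E + 1"
proof (induction rule: hypertree.induct)
  case (hypertree_Join E1 V1 v a E2 V2 s b E3 V3 t c)
  note h = hypertree_Join.hyps
  have roots: "v \<in> V1" "s \<in> V2" "t \<in> V3" using h(1-3)[THEN hypertree_root] by simp_all
  have new: "{v, s, t} \<notin> E1 \<union> E2 \<union> E3"
  proof -
    have "\<not> {v, s, t} \<subseteq> V1" "\<not> {v, s, t} \<subseteq> V2" "\<not> {v, s, t} \<subseteq> V3" using roots h(4-6) by blast+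
    then show ?thesis
      using h(1-3)[THEN hypertree_new_edge, of "{v, s, t}"] by simp
  qed
  note fin = h(1-3)[THEN hypertree_finite]
  have dis: "E1 \<inter> E2 = {}" "(E1 \<union> E2) \<inter> E3 = {}"
    using hypertree_edges_disjoint[OF h(1,2,4)] hypertree_edges_disjoint[OF h(1,3,5)]
      hypertree_edges_disjoint[OF h(2,3,6)] by blast+
  have "card (insert {v, s, t} (E1 \<union> E2 \<union> E3)) = Suc (card E1 + card E2 + card E3)"
    using new fin dis by (simp add: card_Un_disjoint)
  moreover have "(V1 \<union> V2) \<inter> V3 = {}" using h(4-6) by blast
  then have "card (V1 \<union> V2 \<union> V3) = card V1 + card V2 + card V3"
    using h(4) fin by (simp add: card_Un_disjoint)
  ultimately show ?case using hypertree_Join.IH by simp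
qed simp

section \<open>The spectral bound\<close>

text \<open>The factor \<open>1 / 4\<close> absorbs the bound: dividing \<open>6 * (\<Sum>e\<in>E.
  \<Prod>v\<in>e. x v) < 2 * root 3 4 * (\<Sum>v\<in>V. y v)\<close> by \<open>2 * root 3 4\<close>
  leaves \<open>3\<close> times the edge weights on the left.\<close>

definition edge_weight :: "('a \<Rightarrow> real) \<Rightarrow> 'a set \<Rightarrow> real" where
  "edge_weight y e = root 3 ((\<Prod>u\<in>e. y u) / 4)"

definition subcritical :: "'a set set \<Rightarrow> 'a set \<Rightarrow> bool" where
  "subcritical E V \<longleftrightarrow>
     (\<forall>y. (\<forall>v\<in>V. 0 \<le> y v) \<longrightarrow> 0 < (\<Sum>v\<in>V. y v) \<longrightarrow> 3 * (\<Sum>e\<in>E. edge_weight y e) < (\<Sum>v\<in>V. y v))"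

lemma subcriticalD:
  "\<lbrakk>subcritical E V; \<And>v. v \<in> V \<Longrightarrow> 0 \<le> y v; 0 < (\<Sum>v\<in>V. y v)\<rbrakk>
    \<Longrightarrow> 3 * (\<Sum>e\<in>E. edge_weight y e) < (\<Sum>v\<in>V. y v)"
  by (simp add: subcritical_def)

lemma edge_weight_nonneg: "(\<And>u. u \<in> e \<Longrightarrow> 0 \<le> y u) \<Longrightarrow> 0 \<le> edge_weight y e"
  unfolding edge_weight_def by (simp add: prod_nonneg)

lemma edge_weight_cong: "(\<And>u. u \<in> e \<Longrightarrow> y u = z u) \<Longrightarrow> edge_weight y e = edge_weight z e"
  unfolding edge_weight_def by (simp cong: prod.cong)

lemma subcritical_if_spectral_radius_less:
  assumes H: "uniform_hypergraph 3 H" and less: "spectral_radius 3 H < 2 * root 3 4"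
  shows "subcritical (edges H) (verts H)"
  unfolding subcritical_def
proof (intro allI impI)
  fix y :: "'a \<Rightarrow> real"
  assume y: "\<forall>v\<in>verts H. 0 \<le> y v" and pos: "0 < (\<Sum>v\<in>verts H. y v)"
  define x where "x v = root 3 (y v)" for v
  have x: "nonneg_nonzero H x"
    using y pos unfolding nonneg_nonzero_def x_def
    by (metis less_irrefl odd_numeral real_root_ge_0_iff real_root_eq_0_iff sum.neutral zero_less_numeral)
  then have "verts H \<noteq> {}" by (auto simp: nonneg_nonzero_def)
  then have ray: "rayleigh 3 H x < 2 * root 3 4"
    using spectral_radius_attained[OF H] x less by (meson le_less_trans)
  have cube: "x v ^ 3 = y v" for v by (simp add: x_def odd_real_root_pow)
  have "(\<Prod>v\<in>e. x v) = root 3 4 * edge_weight y e" for e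
  proof -
    have "(\<Prod>v\<in>e. x v) ^ 3 = (\<Prod>v\<in>e. y v)" by (simp add: prod_power_distrib cube)
    then have "(\<Prod>v\<in>e. x v) ^ 3 = (root 3 4 * edge_weight y e) ^ 3"
      by (simp add: edge_weight_def power_mult_distrib odd_real_root_pow)
    then show ?thesis by (metis odd_numeral odd_real_root_power_cancel)
  qed
  then have "rayleigh 3 H x = 6 * (root 3 4 * (\<Sum>e\<in>edges H. edge_weight y e)) / (\<Sum>v\<in>verts H. y v)"
    unfolding rayleigh_def cube by (simp add: sum_distrib_left fact_numeral)
  then have "6 * (root 3 4 * (\<Sum>e\<in>edges H. edge_weight y e)) < 2 * root 3 4 * (\<Sum>v\<in>verts H. y v)"
    using ray pos by (simp add: pos_divide_less_eq)
  then have "root 3 4 * (3 * (\<Sum>e\<in>edges H. edge_weight y e)) < root 3 4 * (\<Sum>v\<in>verts H. y v)"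
    by (simp add: algebra_simps)
  then show "3 * (\<Sum>e\<in>edges H. edge_weight y e) < (\<Sum>v\<in>verts H. y v)"
    by (rule mult_left_less_imp_less) simp
qed

lemma subcritical_subset:
  assumes sub: "subcritical E V" and "finite E" "finite V" "E' \<subseteq> E" "V' \<subseteq> V"
    and E: "\<And>e. e \<in> E \<Longrightarrow> e \<subseteq> V" and E': "\<And>e. e \<in> E' \<Longrightarrow> e \<subseteq> V'"
  shows "subcritical E' V'"
  unfolding subcritical_def
proof (intro allI impI)
  fix y :: "'a \<Rightarrow> real"
  assume y: "\<forall>v\<in>V'. 0 \<le> y v" and pos: "0 < (\<Sum>v\<in>V'. y v)"
  define z where "z v = (if v \<in> V' then y v else 0)" for v
  have sum: "(\<Sum>v\<in>V. z v) = (\<Sum>v\<in>V'. y v)"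
    unfolding z_def using assms by (simp add: sum.If_cases Int_absorb1)
  have z: "0 \<le> z v" for v using y by (simp add: z_def)
  have "(\<Sum>e\<in>E'. edge_weight y e) = (\<Sum>e\<in>E'. edge_weight z e)"
    using E' by (intro sum.cong edge_weight_cong) (auto simp: z_def)
  also have "\<dots> \<le> (\<Sum>e\<in>E. edge_weight z e)"
    using assms by (intro sum_mono2) (auto intro: edge_weight_nonneg z)
  finally show "3 * (\<Sum>e\<in>E'. edge_weight y e) < (\<Sum>v\<in>V'. y v)"
    using subcriticalD[OF sub, of z] z sum pos by simp
qed

text \<open>Each vertex splits its weight among its edges so that the three shares received by an
  edge are equal, the equality case of the AM-GM inequality; their sum is then
  \<open>3 * edge_weight\<close>. The balance is \<open>(1 - load t) * w\<close>, unspent at the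
  root or overspent if negative. Goodness is assumed only for the branches, because
  \<open>load t < 1\<close> is what \<open>good_if_subcritical\<close> derives from this
  identity.\<close>

lemma hypertree_weights:
  assumes "hypertree E V v t" "t = Leaf \<or> (\<exists>a b c. t = Join a b c \<and> good a \<and> good b \<and> good c)"
    and "0 < w"
  shows "\<exists>y. y v = w \<and> (\<forall>u\<in>V. 0 < y u) \<and>
    3 * (\<Sum>e\<in>E. edge_weight y e) = (\<Sum>u\<in>V. y u) + (load t - 1) * w"
  using assms
proof (induction arbitrary: w rule: hypertree.induct)
  case (hypertree_Leaf v)
  then show ?case by (intro exI[of _ "\<lambda>_. w"]) simp
next
  case (hypertree_Join E1 V1 v a E2 V2 s b E3 V3 t c)
  note h = hypertree_Join.hyps
  have g: "good a" "good b" "good c" using hypertree_Join.prems by auto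
  have IHprem: "x = Leaf \<or> (\<exists>a b c. x = Join a b c \<and> good a \<and> good b \<and> good c)" if "good x" for x
    using that by (cases x) auto
  let ?b = "1 - load b" and ?c = "1 - load c" and ?g = "edge_load (load b) (load c)"
  have pos: "?b > 0" "?c > 0" using g good_load_less by auto
  \<comment> \<open>\<open>m\<close> is the common share: \<open>v\<close> gives the fraction
    \<open>?g\<close> of its weight, and \<open>s\<close> with weight \<open>m / ?b\<close> has
    \<open>m\<close> left after its own branches took the fraction \<open>load b\<close>; likewise
    for \<open>t\<close>.\<close>
  define m where "m = w * ?g"
  have "?g > 0" using edge_load_pos g good_load_less by blast
  then have m: "m > 0" using hypertree_Join.prems by (simp add: m_def)
  obtain y1 where y1: "y1 v = w" "\<forall>u\<in>V1. 0 < y1 u"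
    "3 * (\<Sum>e\<in>E1. edge_weight y1 e) = (\<Sum>u\<in>V1. y1 u) + (load a - 1) * w"
    using hypertree_Join.IH(1)[OF IHprem[OF g(1)]] hypertree_Join.prems by blast
  obtain y2 where y2: "y2 s = m / ?b" "\<forall>u\<in>V2. 0 < y2 u"
    "3 * (\<Sum>e\<in>E2. edge_weight y2 e) = (\<Sum>u\<in>V2. y2 u) + (load b - 1) * (m / ?b)"
    using hypertree_Join.IH(2)[OF IHprem[OF g(2)], of "m / ?b"] m pos by auto
  obtain y3 where y3: "y3 t = m / ?c" "\<forall>u\<in>V3. 0 < y3 u"
    "3 * (\<Sum>e\<in>E3. edge_weight y3 e) = (\<Sum>u\<in>V3. y3 u) + (load c - 1) * (m / ?c)"
    using hypertree_Join.IH(3)[OF IHprem[OF g(3)], of "m / ?c"] m pos by auto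
  define y where "y u = (if u \<in> V1 then y1 u else if u \<in> V2 then y2 u else y3 u)" for u
  have eq1: "y u = y1 u" if "u \<in> V1" for u using that by (simp add: y_def)
  have eq2: "y u = y2 u" if "u \<in> V2" for u using that h by (auto simp: y_def)
  have eq3: "y u = y3 u" if "u \<in> V3" for u using that h by (auto simp: y_def)
  have roots: "v \<in> V1" "s \<in> V2" "t \<in> V3" using h(1-3)[THEN hypertree_root] by simp_all
  have distinct: "v \<noteq> s" "v \<noteq> t" "s \<noteq> t" using roots h by blast+
  note fin = h(1-3)[THEN hypertree_finite]
  have weights: "(\<Sum>e\<in>F. edge_weight y e) = (\<Sum>e\<in>F. edge_weight z e)"
    if "hypertree F U r x" "\<And>u. u \<in> U \<Longrightarrow> y u = z u" for F U r x z
    using that hypertree_edge_subset[OF that(1)] by (intro sum.cong edge_weight_cong) auto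
  have new: "{v, s, t} \<notin> E1 \<union> E2 \<union> E3"
  proof -
    have "\<not> {v, s, t} \<subseteq> V1" "\<not> {v, s, t} \<subseteq> V2" "\<not> {v, s, t} \<subseteq> V3" using roots h(4-6) by blast+
    then show ?thesis
      using h(1-3)[THEN hypertree_new_edge, of "{v, s, t}"] by simp
  qed
  have dis: "E1 \<inter> E2 = {}" "(E1 \<union> E2) \<inter> E3 = {}" "(V1 \<union> V2) \<inter> V3 = {}"
    using hypertree_edges_disjoint[OF h(1,2,4)] hypertree_edges_disjoint[OF h(1,3,5)]
      hypertree_edges_disjoint[OF h(2,3,6)] h by blast+
  have "(\<Prod>u\<in>{v, s, t}. y u) / 4 = w * (m / ?b) * (m / ?c) / 4"
    using distinct roots eq1 eq2 eq3 y1(1) y2(1) y3(1) by simp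
  also have "\<dots> = m * m * (w * ?g)"
    by (simp only: edge_load_def divide_inverse mult_ac)
  also have "\<dots> = m ^ 3" by (simp add: m_def power3_eq_cube)
  finally have m_eq: "edge_weight y {v, s, t} = m"
    by (simp add: edge_weight_def odd_real_root_power_cancel)
  have sumE: "(\<Sum>e\<in>insert {v, s, t} (E1 \<union> E2 \<union> E3). edge_weight y e) =
      m + (\<Sum>e\<in>E1. edge_weight y1 e) + (\<Sum>e\<in>E2. edge_weight y2 e) + (\<Sum>e\<in>E3. edge_weight y3 e)"
    using new fin dis m_eq weights[OF h(1) eq1] weights[OF h(2) eq2] weights[OF h(3) eq3]
    by (simp add: sum.union_disjoint)
  have "(\<Sum>u\<in>V1 \<union> V2 \<union> V3. y u) = (\<Sum>u\<in>V1. y u) + (\<Sum>u\<in>V2. y u) + (\<Sum>u\<in>V3. y u)"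
    using fin dis h(4) by (simp add: sum.union_disjoint)
  then have sumV: "(\<Sum>u\<in>V1 \<union> V2 \<union> V3. y u) = (\<Sum>u\<in>V1. y1 u) + (\<Sum>u\<in>V2. y2 u) + (\<Sum>u\<in>V3. y3 u)"
    using eq1 eq2 eq3 by simp
  have "(load b - 1) * (m / ?b) = - m" "(load c - 1) * (m / ?c) = - m"
    using pos by (simp_all add: field_simps)
  then have "3 * (\<Sum>e\<in>insert {v, s, t} (E1 \<union> E2 \<union> E3). edge_weight y e) =
      (\<Sum>u\<in>V1 \<union> V2 \<union> V3. y u) + ((load a - 1) * w + m)"
    unfolding sumE sumV using y1(3) y2(3) y3(3) by simp
  also have "(load a - 1) * w + m = (load (Join a b c) - 1) * w"
    by (simp add: m_def algebra_simps)
  finally have "3 * (\<Sum>e\<in>insert {v, s, t} (E1 \<union> E2 \<union> E3). edge_weight y e) =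
      (\<Sum>u\<in>V1 \<union> V2 \<union> V3. y u) + (load (Join a b c) - 1) * w" .
  moreover have "\<forall>u\<in>V1 \<union> V2 \<union> V3. 0 < y u" using eq1 eq2 eq3 y1(2) y2(2) y3(2) by auto
  moreover have "y v = w" using eq1 roots y1(1) by simp
  ultimately show ?case by blast
qed

text \<open>Subcriticality passes to the three branches, which are good by induction. The weights of
  \<open>hypertree_weights\<close> with root weight \<open>1\<close> then turn the strict inequality
  into \<open>load t < 1\<close>.\<close>

lemma good_if_subcritical:
  assumes "hypertree E V v t" "subcritical E V"
  shows "good t"
  using assms
proof (induction rule: hypertree.induct)
  case (hypertree_Join E1 V1 v a E2 V2 s b E3 V3 t c)
  let ?E = "insert {v, s, t} (E1 \<union> E2 \<union> E3)" and ?V = "V1 \<union> V2 \<union> V3"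
  note h = hypertree_Join.hyps
  have ht: "hypertree ?E ?V v (Join a b c)" using h by (rule hypertree.intros)
  note fin = hypertree_finite[OF ht]
  have sub: "subcritical F U" if "hypertree F U r x" "F \<subseteq> ?E" "U \<subseteq> ?V" for F U r x
  proof (rule subcritical_subset[OF hypertree_Join.prems _ _ that(2,3)])
    show "finite ?E" "finite ?V" using fin by simp_all
    show "e \<subseteq> ?V" if "e \<in> ?E" for e using hypertree_edge_subset[OF ht that] ..
    show "e \<subseteq> U" if "e \<in> F" for e using hypertree_edge_subset[OF \<open>hypertree F U r x\<close> that] ..
  qed
  have g: "good a" "good b" "good c"
    by (auto intro!: hypertree_Join.IH sub[OF h(1)] sub[OF h(2)] sub[OF h(3)])
  obtain y where y: "y v = 1" "\<forall>u\<in>?V. 0 < y u"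
    "3 * (\<Sum>e\<in>?E. edge_weight y e) = (\<Sum>u\<in>?V. y u) + (load (Join a b c) - 1) * 1"
    using hypertree_weights[OF ht, of 1] g by auto
  have "0 < (\<Sum>u\<in>?V. y u)"
    using fin y(2) hypertree_root[OF ht] by (intro sum_pos) auto
  then have "3 * (\<Sum>e\<in>?E. edge_weight y e) < (\<Sum>u\<in>?V. y u)"
    using y(2) by (intro subcriticalD[OF hypertree_Join.prems]) (auto intro: less_imp_le)
  then show ?case using g y(3) by simp
qed simp

text \<open>In a minimal violating edge set every edge has at most one private vertex, so giving each
  vertex its degree as weight makes every edge weight at least \<open>1\<close>.\<close>

lemma subcritical_sparse:
  assumes sub: "subcritical E V" and fin: "finite V" and E: "\<And>e. e \<in> E \<Longrightarrow> e \<subseteq> V \<and> card e = 3"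
    and S: "S \<subseteq> E" "S \<noteq> {}"
  shows "2 * card S + 1 \<le> card (\<Union> S)"
proof -
  have finE: "finite E" by (rule finite_subset[of _ "Pow V"]) (use E fin in auto)
  then have "finite S" using S finite_subset by blast
  then show ?thesis using S
  proof (induction rule: finite_psubset_induct)
    case (psubset S)
    show ?case
    proof (rule ccontr)
      assume "\<not> ?thesis"
      then have few: "card (\<Union> S) \<le> 2 * card S" by simp
      have finU: "finite (\<Union> S)" using psubset.prems(1) E fin by (meson Sup_least finite_subset subset_eq)
      define y where "y u = real (card {e \<in> S. u \<in> e})" for u
      have "(\<Sum>u\<in>\<Union> S. y u) = (\<Sum>u\<in>\<Union> S. \<Sum>e\<in>S. if u \<in> e then 1 else 0)"
        unfolding y_def using psubset.hyps by (simp add: sum.If_cases Int_def)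
      also have "\<dots> = (\<Sum>e\<in>S. \<Sum>u\<in>\<Union> S. if u \<in> e then 1 else 0)" by (rule sum.swap)
      also have "\<dots> = (\<Sum>e\<in>S. real (card e))"
      proof (intro sum.cong refl)
        fix e assume "e \<in> S"
        then have "\<Union> S \<inter> {u. u \<in> e} = e" by blast
        then show "(\<Sum>u\<in>\<Union> S. if u \<in> e then 1 else 0) = real (card e)"
          using finU by (simp add: sum.If_cases)
      qed
      also have "\<dots> = 3 * real (card S)" using E psubset.prems(1) by (simp add: subset_eq)
      finally have sumV: "(\<Sum>u\<in>\<Union> S. y u) = 3 * real (card S)" .
      have "1 \<le> edge_weight y e" if e: "e \<in> S" for e
      proof -
        define P where "P = e - \<Union> (S - {e})"
        \<comment> \<open>A single edge has three vertices and violates nothing, so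
          \<open>S - {e}\<close> is nonempty and falls under the induction hypothesis.\<close>
        have "S \<noteq> {e}"
        proof
          assume "S = {e}"
          then show False using few e E[of e] psubset.prems(1) by simp
        qed
        then have ne: "S - {e} \<noteq> {}" using e by blast
        then have "2 * card (S - {e}) + 1 \<le> card (\<Union> (S - {e}))"
          using psubset.prems e by (intro psubset.IH) auto
        moreover have "card (S - {e}) = card S - 1" using e psubset.hyps by simp
        moreover have "card S \<ge> 1" using e psubset.hyps
          by (metis One_nat_def Suc_leI card_gt_0_iff empty_iff)
        \<comment> \<open>\<open>S\<close> has at most \<open>2 * card S\<close> vertices and
          \<open>S - {e}\<close> at least \<open>2 * card S - 1\<close>, so \<open>e\<close> has at
          most one private vertex.\<close>
        ultimately have "card (\<Union> S) \<le> card (\<Union> (S - {e})) + 1" using few by linarith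
        moreover have "card (\<Union> S) = card (\<Union> (S - {e})) + card P"
        proof -
          have "\<Union> S = \<Union> (S - {e}) \<union> P" using e by (auto simp: P_def)
          moreover have "card (\<Union> (S - {e}) \<union> P) = card (\<Union> (S - {e})) + card P"
            using e by (intro card_Un_disjoint finite_subset[OF _ finU]) (auto simp: P_def)
          ultimately show ?thesis by simp
        qed
        ultimately have "card P \<le> 1" by simp
        have e3: "card e = 3" "finite e" "P \<subseteq> e"
          using e E[of e] psubset.prems(1) fin by (auto simp: P_def intro: finite_subset)
        then have two: "2 \<le> card (e - P)" using \<open>card P \<le> 1\<close>
          by (simp add: card_Diff_subset finite_subset)
        have deg1: "1 \<le> y u" if "u \<in> e" for u
        proof -
          have "card {e} \<le> card {e \<in> S. u \<in> e}"
            using psubset.hyps e that by (intro card_mono) auto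
          then show ?thesis by (simp add: y_def)
        qed
        have deg2: "2 \<le> y u" if u: "u \<in> e - P" for u
        proof -
          obtain e' where "e' \<in> S" "e' \<noteq> e" "u \<in> e'" using u by (auto simp: P_def)
          then have "card {e, e'} \<le> card {e \<in> S. u \<in> e}"
            using psubset.hyps e u by (intro card_mono) auto
          then show ?thesis using \<open>e' \<noteq> e\<close> by (simp add: y_def)
        qed
        \<comment> \<open>Two vertices of degree at least \<open>2\<close> make the product at least
          \<open>4\<close>, which cancels the \<open>4\<close> in \<open>edge_weight\<close>. The
          total edge weight then reaches \<open>card S\<close>, while the degrees sum to
          \<open>3 * card S\<close>.\<close>
        have "(2 :: real) ^ 2 \<le> 2 ^ card (e - P)" using two by (intro power_increasing) auto
        also have "\<dots> = (\<Prod>u\<in>e - P. 2)" by simp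
        also have "\<dots> \<le> (\<Prod>u\<in>e - P. y u)" by (intro prod_mono) (auto intro: deg2)
        also have "\<dots> \<le> (\<Prod>u\<in>e. y u)"
        proof -
          have "(\<Prod>u\<in>e. y u) = (\<Prod>u\<in>e - P. y u) * (\<Prod>u\<in>P. y u)"
            using e3 by (intro prod.subset_diff) auto
          moreover have "1 \<le> (\<Prod>u\<in>P. y u)" using deg1 e3 by (intro prod_ge_1) auto
          moreover have "0 \<le> (\<Prod>u\<in>e - P. y u)" by (intro prod_nonneg) (simp add: y_def)
          ultimately show ?thesis by (simp add: mult_le_cancel_left1)
        qed
        finally show ?thesis unfolding edge_weight_def by (simp add: real_root_ge_1_iff)
      qed
      then have "real (card S) \<le> (\<Sum>e\<in>S. edge_weight y e)"
        using sum_mono[of S "\<lambda>_. 1" "edge_weight y"] by simp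
      moreover have "subcritical S (\<Union> S)"
        using psubset.prems(1) E finE fin by (intro subcritical_subset[OF sub]) blast+
      then have "3 * (\<Sum>e\<in>S. edge_weight y e) < (\<Sum>u\<in>\<Union> S. y u)"
      proof (rule subcriticalD)
        show "0 \<le> y u" for u by (simp add: y_def)
        show "0 < (\<Sum>u\<in>\<Union> S. y u)"
          unfolding sumV using psubset.hyps psubset.prems by (simp add: card_gt_0_iff)
      qed
      ultimately show False using sumV by simp
    qed
  qed
qed

section \<open>From subcriticality to a spanning hypertree\<close>

lemma hconnected_boundary_edge:
  assumes "hconnected H" "v \<in> verts H" "v \<in> U" "w \<in> verts H" "w \<notin> U"
  shows "\<exists>e\<in>edges H. e \<inter> U \<noteq> {} \<and> \<not> e \<subseteq> U"
proof -
  obtain vs es where walk: "hwalk H vs es" "hd vs = v" "last vs = w"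
    using assms unfolding hconnected_def by blast
  then have len: "length vs = Suc (length es)" by (simp add: hwalk_def)
  have ends: "vs ! 0 \<in> U" "vs ! length es \<notin> U"
    using walk len assms by (metis hd_conv_nth length_0_conv nat.distinct(1))
      (metis walk(3) len assms(5) diff_Suc_1 last_conv_nth length_0_conv nat.distinct(1))
  have "\<exists>i<length es. vs ! i \<in> U \<and> vs ! Suc i \<notin> U"
  proof (rule ccontr)
    assume "\<not> ?thesis"
    then have "vs ! i \<in> U" if "i \<le> length es" for i
      using that ends(1) by (induction i) auto
    then show False using ends(2) by simp
  qed
  then obtain i where "i < length es" "vs ! i \<in> U" "vs ! Suc i \<notin> U" by blast
  then show ?thesis using walk(1) unfolding hwalk_def by (metis IntI empty_iff nth_mem subset_eq)
qed

text \<open>Take a hypertree at \<open>v\<close> with as many edges as possible. If it misses a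
  vertex, connectedness yields an edge leaving its vertex set; the sparsity bound lets this edge
  meet the hypertree in only one vertex, so it could be attached.\<close>

lemma subcritical_imp_hypertree:
  assumes H: "uniform_hypergraph 3 H" and conn: "hconnected H"
    and sub: "subcritical (edges H) (verts H)" and v: "v \<in> verts H"
  shows "\<exists>t. hypertree (edges H) (verts H) v t"
proof -
  let ?E = "edges H" and ?V = "verts H"
  have fin: "finite ?V" and E: "\<And>e. e \<in> ?E \<Longrightarrow> e \<subseteq> ?V \<and> card e = 3"
    using H by (auto simp: uniform_hypergraph_def)
  note sparse = subcritical_sparse[OF sub fin E]
  have finE: "finite ?E" by (rule finite_subset[of _ "Pow ?V"]) (use E fin in auto)
  define P where "P S \<longleftrightarrow> S \<subseteq> ?E \<and> (\<exists>U t. U \<subseteq> ?V \<and> hypertree S U v t)" for S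
  have "P {}" unfolding P_def using v by (intro conjI exI[of _ "{v}"] exI[of _ Leaf]) (auto intro: hypertree_Leaf)
  moreover have "\<forall>S. P S \<longrightarrow> card S < Suc (card ?E)"
    unfolding P_def using finE by (auto intro: card_mono simp: less_Suc_eq_le)
  ultimately obtain S where S: "P S" and max: "\<And>S'. P S' \<Longrightarrow> card S' \<le> card S"
    using ex_has_greatest_nat[of P "{}" card "Suc (card ?E)"] by (metis less_imp_le)
  obtain U t where t: "hypertree S U v t" and U: "U \<subseteq> ?V" and SE: "S \<subseteq> ?E"
    using S by (auto simp: P_def)
  note finSU = hypertree_finite[OF t]
  \<comment> \<open>The bound exceeds \<open>card U = 2 * card S + 1\<close> by two: every further
    edge adds two vertices, and once \<open>U\<close> is everything there is none left.\<close>
  have large: "2 * card S + 3 \<le> card (U \<union> e)" if e: "e \<in> ?E" "e \<notin> S" for e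
  proof -
    have "2 * card (insert e S) + 1 \<le> card (\<Union> (insert e S))"
      using e SE by (intro sparse) auto
    also have "\<dots> \<le> card (U \<union> e)"
      using hypertree_edge_subset[OF t] finSU E[OF e(1)] fin
      by (intro card_mono) (auto intro: finite_subset)
    finally show ?thesis using e finSU by simp
  qed
  have "U = ?V"
  proof (rule ccontr)
    assume "U \<noteq> ?V"
    then obtain w where "w \<in> ?V" "w \<notin> U" using U by blast
    then obtain e where e: "e \<in> ?E" "e \<inter> U \<noteq> {}" "\<not> e \<subseteq> U"
      using hconnected_boundary_edge[OF conn v hypertree_root[OF t]] by blast
    have eS: "e \<notin> S" using e hypertree_edge_subset[OF t] by blast
    have fe: "finite e" "card e = 3" "e \<subseteq> ?V" using E[OF e(1)] fin by (auto intro: finite_subset)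
    have "card (U \<union> e) = card U + card (e - U)"
      using finSU fe card_Un_disjoint[of U "e - U"] by (simp add: Un_Diff_cancel)
    then have "2 \<le> card (e - U)" using large[OF e(1) eS] hypertree_card[OF t] by simp
    moreover have "card (e - U) + card (e \<inter> U) = 3"
      using fe by (metis Int_commute add.commute card_Diff_subset_Int card_Int_Diff)
    moreover have "card (e \<inter> U) \<ge> 1" using e(2) fe by (simp add: Suc_leI card_gt_0_iff)
    ultimately have "card (e - U) = 2" "card (e \<inter> U) = 1" by linarith+
    then obtain u x y where uxy: "e \<inter> U = {u}" "e - U = {x, y}" "x \<noteq> y"
      by (auto simp: card_1_singleton_iff card_2_iff)
    then have e_eq: "e = {u, x, y}" by blast
    have in_U: "u \<in> U" "x \<notin> U" "y \<notin> U" using uxy by blast+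
    obtain t' where "hypertree (insert e S) (U \<union> {x, y}) v t'"
      using hypertree_attach_edge[OF t in_U uxy(3)] unfolding e_eq[symmetric] by blast
    moreover have "insert e S \<subseteq> ?E" "U \<union> {x, y} \<subseteq> ?V" using SE e(1) U fe(3) e_eq by auto
    ultimately have "P (insert e S)" unfolding P_def by blast
    then have "card (insert e S) \<le> card S" by (rule max)
    then show False using eS finSU by simp
  qed
  moreover have "S = ?E"
  proof (rule ccontr)
    assume "S \<noteq> ?E"
    then obtain e where "e \<in> ?E" "e \<notin> S" using SE by blast
    then show False
      using large[of e] E[of e] \<open>U = ?V\<close> hypertree_card[OF t] by (simp add: Un_absorb2)
  qed
  ultimately show ?thesis using t by blast
qed

section \<open>The shapes of the special hypergraphs\<close>

definition realizes :: "'a hypergraph \<Rightarrow> htree \<Rightarrow> bool" where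
  "realizes H t \<longleftrightarrow> (\<exists>v. hypertree (edges H) (verts H) v t)"

lemma realizes_isomorphic:
  assumes "realizes H t" "realizes K t"
  shows "hisomorphic H K"
proof -
  obtain v w where "hypertree (edges H) (verts H) v t" "hypertree (edges K) (verts K) w t"
    using assms by (auto simp: realizes_def)
  then show ?thesis unfolding hisomorphic_def using hypertree_isomorphic by metis
qed

lemma hypertree_graft:
  assumes "hypertree E' V' v b" "hypertree E V v a" "V \<inter> V' = {v}"
  shows "hypertree (E \<union> E') (V \<union> V') v (graft a b)"
  using assms
proof (induction rule: hypertree.induct)
  case (hypertree_Leaf v)
  then show ?case using hypertree_root[of E V v a] by (simp add: insert_absorb)
next
  case (hypertree_Join E1 V1 v b1 E2 V2 s b2 E3 V3 t b3)
  note h = hypertree_Join.hyps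
  have v: "v \<in> V1" by (rule hypertree_root[OF h(1)])
  have "V \<inter> V1 = {v}" using hypertree_Join.prems(2) v by blast
  then have "hypertree (E \<union> E1) (V \<union> V1) v (graft a b1)"
    using hypertree_Join.IH(1) hypertree_Join.prems(1) by simp
  then have "hypertree (E \<union> insert {v, s, t} (E1 \<union> E2 \<union> E3)) (V \<union> (V1 \<union> V2 \<union> V3)) v
      (Join (graft a b1) b2 b3)"
    by (rule hypertree_JoinI[OF _ h(2,3)]) (use h(4-6) hypertree_Join.prems(2) v in blast)+
  then show ?case by simp
qed

text \<open>The numbering by \<open>Suc (Max (verts H))\<close> is hidden here: later gluing uses
  only that the new part is a path rooted at \<open>v\<close> that meets the old vertices in
  \<open>v\<close> alone.\<close>

lemma attach_path_hypertree:
  assumes "finite (verts H)" "v \<in> verts H"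
  obtains F W where "hypertree F (insert v W) v (path_tree k)" "W \<inter> verts H = {}"
    "verts (attach_path v k H) = verts H \<union> W" "edges (attach_path v k H) = edges H \<union> F"
  using assms
proof (induction k arbitrary: v H thesis)
  case 0
  show ?case by (rule "0.prems"(1)[of "{}" "{}"]) (simp_all add: hypertree_Leaf)
next
  case (Suc k)
  define n where "n = Suc (Max (verts H))"
  define H' where "H' = attach_edge v H"
  have H': "verts H' = verts H \<union> {n, Suc n}" "edges H' = insert {v, n, Suc n} (edges H)"
    by (simp_all add: H'_def attach_edge_def n_def Let_def)
  have less: "u < n" if "u \<in> verts H" for u
    using Suc.prems(2) that by (simp add: n_def less_Suc_eq_le)
  have new: "n \<notin> verts H" "Suc n \<notin> verts H" using less by fastforce+
  obtain F W where FW: "hypertree F (insert n W) n (path_tree k)" "W \<inter> verts H' = {}"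
    "verts (attach_path n k H') = verts H' \<union> W" "edges (attach_path n k H') = edges H' \<union> F"
    using Suc.IH[of n H'] Suc.prems(2) H' by auto
  have v: "v \<in> verts H" by (rule Suc.prems)
  have "hypertree (insert {v, n, Suc n} F) (insert v ({n, Suc n} \<union> W)) v (Join Leaf Leaf (path_tree k))"
    by (rule hypertree_JoinI[OF hypertree_Leaf[of v] hypertree_Leaf[of "Suc n"] FW(1)])
      (use v new FW(2) H'(1) in auto)
  moreover have "attach_path v (Suc k) H = attach_path n k H'" by (simp add: H'_def n_def)
  ultimately show ?case
    using FW H' new by (intro Suc.prems(1)[of "insert {v, n, Suc n} F" "{n, Suc n} \<union> W"]) auto
qed

lemma realizes_hypF: "realizes (hypF i j k) (Join (path_tree i) (path_tree j) (path_tree k))"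
proof -
  define H0 :: "nat hypergraph" where "H0 = ({0, 1, 2}, {{0, 1, 2}})"
  define H1 where "H1 = attach_path 0 i H0"
  define H2 where "H2 = attach_path 1 j H1"
  have V0: "verts H0 = {0, 1, 2}" and E0: "edges H0 = {{0, 1, 2}}"
    by (simp_all add: H0_def)
  obtain F1 W1 where 1: "hypertree F1 (insert 0 W1) 0 (path_tree i)" "W1 \<inter> verts H0 = {}"
    "verts H1 = verts H0 \<union> W1" "edges H1 = edges H0 \<union> F1"
    unfolding H1_def
    by (rule attach_path_hypertree[of H0 0 i]) (auto simp: V0)
  have fin1: "finite (verts H1)" using hypertree_finite[OF 1(1)] unfolding 1(3) V0 by simp
  obtain F2 W2 where 2: "hypertree F2 (insert 1 W2) 1 (path_tree j)" "W2 \<inter> verts H1 = {}"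
    "verts H2 = verts H1 \<union> W2" "edges H2 = edges H1 \<union> F2"
    unfolding H2_def
    by (rule attach_path_hypertree[OF fin1, of 1 j]) (use 1(3) V0 in auto)
  have fin2: "finite (verts H2)" using fin1 hypertree_finite[OF 2(1)] unfolding 2(3) by simp
  obtain F3 W3 where 3: "hypertree F3 (insert 2 W3) 2 (path_tree k)" "W3 \<inter> verts H2 = {}"
    "verts (hypF i j k) = verts H2 \<union> W3" "edges (hypF i j k) = edges H2 \<union> F3"
    unfolding hypF_def H0_def[symmetric] H1_def[symmetric] H2_def[symmetric]
    by (rule attach_path_hypertree[OF fin2, of 2 k]) (use 1(3) 2(3) V0 in auto)
  have "hypertree (edges (hypF i j k)) (verts (hypF i j k)) 0 (Join (path_tree i) (path_tree j) (path_tree k))"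
    by (rule hypertree_JoinI[OF 1(1) 2(1) 3(1)])
      (use 1(2-4) 2(2-4) 3(2-4) V0 E0 in auto)
  then show ?thesis by (auto simp: realizes_def)
qed

lemma realizes_hypE: "realizes (hypE i j k) (graft (graft (path_tree i) (path_tree j)) (path_tree k))"
proof -
  define H0 :: "nat hypergraph" where "H0 = ({0}, {})"
  define H1 where "H1 = attach_path 0 i H0"
  define H2 where "H2 = attach_path 0 j H1"
  have V0: "verts H0 = {0}" and E0: "edges H0 = {}"
    by (simp_all add: H0_def)
  obtain F1 W1 where 1: "hypertree F1 (insert 0 W1) 0 (path_tree i)" "W1 \<inter> verts H0 = {}"
    "verts H1 = verts H0 \<union> W1" "edges H1 = edges H0 \<union> F1"
    unfolding H1_def
    by (rule attach_path_hypertree[of H0 0 i]) (auto simp: V0)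
  have fin1: "finite (verts H1)" using hypertree_finite[OF 1(1)] unfolding 1(3) V0 by simp
  obtain F2 W2 where 2: "hypertree F2 (insert 0 W2) 0 (path_tree j)" "W2 \<inter> verts H1 = {}"
    "verts H2 = verts H1 \<union> W2" "edges H2 = edges H1 \<union> F2"
    unfolding H2_def
    by (rule attach_path_hypertree[OF fin1, of 0 j]) (use 1(3) V0 in auto)
  have fin2: "finite (verts H2)" using fin1 hypertree_finite[OF 2(1)] unfolding 2(3) by simp
  obtain F3 W3 where 3: "hypertree F3 (insert 0 W3) 0 (path_tree k)" "W3 \<inter> verts H2 = {}"
    "verts (hypE i j k) = verts H2 \<union> W3" "edges (hypE i j k) = edges H2 \<union> F3"
    unfolding hypE_def H0_def[symmetric] H1_def[symmetric] H2_def[symmetric]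
    by (rule attach_path_hypertree[OF fin2, of 0 k]) (use 1(3) 2(3) V0 in auto)
  have "hypertree (F1 \<union> F2) (insert 0 W1 \<union> insert 0 W2) 0 (graft (path_tree i) (path_tree j))"
    by (rule hypertree_graft[OF 2(1) 1(1)]) (use 1(3) 2(2) V0 in auto)
  then have "hypertree (F1 \<union> F2 \<union> F3) (insert 0 W1 \<union> insert 0 W2 \<union> insert 0 W3) 0
      (graft (graft (path_tree i) (path_tree j)) (path_tree k))"
    by (rule hypertree_graft[OF 3(1)]) (use 1(3) 2(3) 3(2) V0 in auto)
  moreover have "edges (hypE i j k) = F1 \<union> F2 \<union> F3"
    "verts (hypE i j k) = insert 0 W1 \<union> insert 0 W2 \<union> insert 0 W3"
    using 1(3,4) 2(3,4) 3(3,4) V0 E0 by auto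
  ultimately show ?thesis by (auto simp: realizes_def)
qed

text \<open>The vertex range is half-open because the last vertex \<open>2 * b\<close> of the
  segment is the root of \<open>t\<close> and already belongs to \<open>V\<close>.\<close>

lemma hypertree_path_segment:
  assumes "a \<le> b" "hypertree E V (2 * b) t" "V \<inter> {2 * a..<2 * b} = {}"
  shows "hypertree (path_edge ` {a..<b} \<union> E) ({2 * a..<2 * b} \<union> V) (2 * a) (chain (b - a) t)"
  using assms
proof (induction a rule: inc_induct)
  case base
  then show ?case by simp
next
  case (step a)
  let ?E = "path_edge ` {Suc a..<b} \<union> E" and ?V = "{2 * Suc a..<2 * b} \<union> V"
  have IH: "hypertree ?E ?V (2 * Suc a) (chain (b - Suc a) t)"
    by (rule step.IH[OF step.prems(1)]) (use step.prems(2) in fastforce)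
  have a: "2 * a \<in> {2 * a..<2 * b}" "Suc (2 * a) \<in> {2 * a..<2 * b}" using step.hyps by auto
  then have notV: "2 * a \<notin> V" "Suc (2 * a) \<notin> V" using step.prems(2) by blast+
  have "{a..<b} = insert a {Suc a..<b}" using step.hyps by auto
  then have E: "path_edge ` {a..<b} \<union> E = insert (path_edge a) ?E" by simp
  have V: "{2 * a..<2 * b} \<union> V = {2 * a} \<union> {Suc (2 * a)} \<union> ?V" using step.hyps by auto
  have "hypertree (path_edge ` {a..<b} \<union> E) ({2 * a..<2 * b} \<union> V) (2 * a)
      (Join Leaf Leaf (chain (b - Suc a) t))"
    unfolding E V
    by (rule hypertree_JoinI[OF hypertree_Leaf hypertree_Leaf IH])
      (use notV in \<open>auto simp: path_edge_def\<close>)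
  moreover have "chain (b - a) t = Join Leaf Leaf (chain (b - Suc a) t)"
    using step.hyps by (simp flip: Suc_diff_Suc)
  ultimately show ?case by simp
qed

lemma realizes_hypA: "realizes (hypA n) (path_tree n)"
proof -
  have "hypertree (path_edge ` {0..<n} \<union> {}) ({2 * 0..<2 * n} \<union> {2 * n}) (2 * 0) (chain (n - 0) Leaf)"
    by (rule hypertree_path_segment) (auto intro: hypertree_Leaf)
  moreover have "{2 * 0..<2 * n} \<union> {2 * n} = {0..2 * n}" by auto
  ultimately have "hypertree (edges (hypA n)) (verts (hypA n)) 0 (path_tree n)"
    by (simp add: hypA_def atLeast0LessThan)
  then show ?thesis by (auto simp: realizes_def)
qed

text \<open>With root \<open>0\<close>, \<open>path_edge 0\<close> is the outermost edge,
  \<open>path_edge 1\<close> to \<open>path_edge k\<close> form the chain, and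
  \<open>path_edge (k + 1)\<close> is the edge of the fork.\<close>

lemma realizes_hypG:
  "realizes (hypG i j k l m) (Join (path_tree i) (path_tree j) (chain k (fork l m)))"
proof -
  define H0 where "H0 = hypA (k + 2)"
  define H1 where "H1 = attach_path 0 i H0"
  define H2 where "H2 = attach_path 1 j H1"
  define H3 where "H3 = attach_path (2 * k + 3) l H2"
  have V0: "verts H0 = {0..2 * k + 4}" and E0: "edges H0 = path_edge ` {..<k + 2}"
    by (simp_all add: H0_def hypA_def)
  have fin0: "finite (verts H0)" unfolding V0 by simp
  obtain F1 W1 where 1: "hypertree F1 (insert 0 W1) 0 (path_tree i)" "W1 \<inter> verts H0 = {}"
    "verts H1 = verts H0 \<union> W1" "edges H1 = edges H0 \<union> F1"
    unfolding H1_def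
    by (rule attach_path_hypertree[OF fin0, of 0 i]) (auto simp: V0)
  have fin1: "finite (verts H1)" using fin0 hypertree_finite[OF 1(1)] unfolding 1(3) by simp
  obtain F2 W2 where 2: "hypertree F2 (insert 1 W2) 1 (path_tree j)" "W2 \<inter> verts H1 = {}"
    "verts H2 = verts H1 \<union> W2" "edges H2 = edges H1 \<union> F2"
    unfolding H2_def
    by (rule attach_path_hypertree[OF fin1, of 1 j]) (use 1(3) V0 in auto)
  have fin2: "finite (verts H2)" using fin1 hypertree_finite[OF 2(1)] unfolding 2(3) by simp
  obtain F3 W3 where 3: "hypertree F3 (insert (2 * k + 3) W3) (2 * k + 3) (path_tree l)" "W3 \<inter> verts H2 = {}"
    "verts H3 = verts H2 \<union> W3" "edges H3 = edges H2 \<union> F3"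
    unfolding H3_def
    by (rule attach_path_hypertree[OF fin2, of "2 * k + 3" l]) (use 1(3) 2(3) V0 in auto)
  have fin3: "finite (verts H3)" using fin2 hypertree_finite[OF 3(1)] unfolding 3(3) by simp
  obtain F4 W4 where 4: "hypertree F4 (insert (2 * k + 4) W4) (2 * k + 4) (path_tree m)" "W4 \<inter> verts H3 = {}"
    "verts (hypG i j k l m) = verts H3 \<union> W4" "edges (hypG i j k l m) = edges H3 \<union> F4"
    unfolding hypG_def H0_def[symmetric] H1_def[symmetric] H2_def[symmetric] H3_def[symmetric]
    by (rule attach_path_hypertree[OF fin3, of "2 * k + 4" m]) (use 1(3) 2(3) 3(3) V0 in auto)
  have disj: "W1 \<inter> {0..2 * k + 4} = {}" "W2 \<inter> {0..2 * k + 4} = {}" "W3 \<inter> {0..2 * k + 4} = {}"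
    "W4 \<inter> {0..2 * k + 4} = {}" "W1 \<inter> W2 = {}" "W1 \<inter> W3 = {}" "W1 \<inter> W4 = {}" "W2 \<inter> W3 = {}"
    "W2 \<inter> W4 = {}" "W3 \<inter> W4 = {}"
    using 1(2) 2(2) 3(2) 4(2) unfolding 1(3) 2(3) 3(3) V0 by blast+
  have out: "x \<notin> W1" "x \<notin> W2" "x \<notin> W3" "x \<notin> W4" if "x \<le> 2 * k + 4" for x
    using disj(1-4) that by auto
  let ?E = "insert (path_edge (k + 1)) (F3 \<union> F4)"
    and ?V = "{2 * k + 2} \<union> insert (2 * k + 3) W3 \<union> insert (2 * k + 4) W4"
  have last: "hypertree ?E ?V (2 * (k + 1)) (fork l m)"
    by (rule hypertree_JoinI[OF hypertree_Leaf 3(1) 4(1)])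
      (use out disj(10) in \<open>auto simp: path_edge_def\<close>)
  have "hypertree (path_edge ` {1..<k + 1} \<union> ?E) ({2 * 1..<2 * (k + 1)} \<union> ?V) (2 * 1)
      (chain (k + 1 - 1) (fork l m))"
    by (rule hypertree_path_segment[OF _ last]) (use out in auto)
  then have rest: "hypertree (path_edge ` {1..<k + 1} \<union> ?E) ({2..<2 * (k + 1)} \<union> ?V) 2
      (chain k (fork l m))" by simp
  have idx: "{..<k + 2} = insert 0 (insert (k + 1) {1..<k + 1})" by auto
  have "edges (hypG i j k l m) = insert {0, 1, 2} (F1 \<union> F2 \<union> (path_edge ` {1..<k + 1} \<union> ?E))"
    unfolding 4(4) 3(4) 2(4) 1(4) E0 idx by (auto simp: path_edge_def)
  moreover have "verts (hypG i j k l m) = insert 0 W1 \<union> insert 1 W2 \<union> ({2..<2 * (k + 1)} \<union> ?V)"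
    unfolding 4(3) 3(3) 2(3) 1(3) V0 by auto
  ultimately have "hypertree (edges (hypG i j k l m)) (verts (hypG i j k l m)) 0
      (Join (path_tree i) (path_tree j) (chain k (fork l m)))"
    by (intro hypertree_JoinI[OF 1(1) 2(1) rest]) (use out disj in auto)
  then show ?thesis by (auto simp: realizes_def)
qed

text \<open>The root is the vertex \<open>2\<close>, where \<open>path_edge 0\<close> and the first
  attached edge are the two pendant edges. The edge of the fork is the last but one of the path; its
  branches are the second attached edge and the last edge \<open>path_edge (k + 2)\<close>.\<close>

lemma realizes_hypBD:
  "realizes (hypBD (k + 5)) (graft (graft (path_tree 1) (path_tree 1)) (chain k (fork 1 1)))"
proof -
  define H0 where "H0 = hypA (k + 3)"
  define H1 where "H1 = attach_path 2 1 H0"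
  have eq: "hypBD (k + 5) = attach_path (2 * k + 3) 1 H1"
  proof -
    have "2 * (k + 5) - 7 = 2 * k + 3" "k + 5 - 2 = k + 3" by simp_all
    then show ?thesis unfolding hypBD_def H0_def H1_def by (simp only:)
  qed
  have V0: "verts H0 = {0..2 * k + 6}" and E0: "edges H0 = path_edge ` {..<k + 3}"
    by (simp_all add: H0_def hypA_def)
  have fin0: "finite (verts H0)" unfolding V0 by simp
  obtain F1 W1 where 1: "hypertree F1 (insert 2 W1) 2 (path_tree 1)" "W1 \<inter> verts H0 = {}"
    "verts H1 = verts H0 \<union> W1" "edges H1 = edges H0 \<union> F1"
    unfolding H1_def
    by (rule attach_path_hypertree[OF fin0, of 2 1]) (auto simp: V0)
  have fin1: "finite (verts H1)" using fin0 hypertree_finite[OF 1(1)] unfolding 1(3) by simp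
  obtain F2 W2 where 2: "hypertree F2 (insert (2 * k + 3) W2) (2 * k + 3) (path_tree 1)"
    "W2 \<inter> verts H1 = {}" "verts (hypBD (k + 5)) = verts H1 \<union> W2"
    "edges (hypBD (k + 5)) = edges H1 \<union> F2"
    unfolding eq
    by (rule attach_path_hypertree[OF fin1, of "2 * k + 3" 1]) (use 1(3) V0 in auto)
  have disj: "W1 \<inter> {0..2 * k + 6} = {}" "W2 \<inter> {0..2 * k + 6} = {}" "W1 \<inter> W2 = {}"
    using 1(2) 2(2) unfolding 1(3) V0 by blast+
  have out: "x \<notin> W1" "x \<notin> W2" if "x \<le> 2 * k + 6" for x
    using disj(1,2) that by auto
  have first: "hypertree {path_edge 0} {0, 1, 2} 2 (path_tree 1)"
    unfolding One_nat_def chain.simps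
    by (rule hypertree_JoinI[OF hypertree_Leaf hypertree_Leaf[of 0] hypertree_Leaf[of 1]])
      (auto simp: path_edge_def)
  have end_edge: "hypertree {path_edge (k + 2)} {2 * k + 4, 2 * k + 5, 2 * k + 6} (2 * k + 4) (path_tree 1)"
    unfolding One_nat_def chain.simps
    by (rule hypertree_JoinI[OF hypertree_Leaf hypertree_Leaf[of "2 * k + 5"] hypertree_Leaf[of "2 * k + 6"]])
      (auto simp: path_edge_def)
  let ?E = "insert (path_edge (k + 1)) (F2 \<union> {path_edge (k + 2)})"
    and ?V = "{2 * k + 2} \<union> insert (2 * k + 3) W2 \<union> {2 * k + 4, 2 * k + 5, 2 * k + 6}"
  have last: "hypertree ?E ?V (2 * (k + 1)) (fork 1 1)"
    by (rule hypertree_JoinI[OF hypertree_Leaf 2(1) end_edge])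
      (use out in \<open>auto simp: path_edge_def\<close>)
  have "hypertree (path_edge ` {1..<k + 1} \<union> ?E) ({2 * 1..<2 * (k + 1)} \<union> ?V) (2 * 1)
      (chain (k + 1 - 1) (fork 1 1))"
    by (rule hypertree_path_segment[OF _ last]) (use out in auto)
  then have rest: "hypertree (path_edge ` {1..<k + 1} \<union> ?E) ({2..<2 * (k + 1)} \<union> ?V) 2
      (chain k (fork 1 1))" by simp
  have "hypertree ({path_edge 0} \<union> F1) ({0, 1, 2} \<union> insert 2 W1) 2 (graft (path_tree 1) (path_tree 1))"
    by (rule hypertree_graft[OF 1(1) first]) (use out in auto)
  then have "hypertree ({path_edge 0} \<union> F1 \<union> (path_edge ` {1..<k + 1} \<union> ?E))
      ({0, 1, 2} \<union> insert 2 W1 \<union> ({2..<2 * (k + 1)} \<union> ?V)) 2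
      (graft (graft (path_tree 1) (path_tree 1)) (chain k (fork 1 1)))"
    by (rule hypertree_graft[OF rest]) (use out disj hypertree_root[OF rest] in auto)
  moreover have idx: "{..<k + 3} = insert 0 (insert (k + 1) (insert (k + 2) {1..<k + 1}))" by auto
  have "edges (hypBD (k + 5)) = {path_edge 0} \<union> F1 \<union> (path_edge ` {1..<k + 1} \<union> ?E)"
    unfolding 2(4) 1(4) E0 idx by auto
  moreover have "verts (hypBD (k + 5)) = {0, 1, 2} \<union> insert 2 W1 \<union> ({2..<2 * (k + 1)} \<union> ?V)"
    unfolding 2(3) 1(3) V0 by auto
  ultimately show ?thesis by (auto simp: realizes_def)
qed

theorem theorem2:
  fixes H :: "'a hypergraph"
  assumes "uniform_hypergraph 3 H"
    and "edges H \<noteq> {}"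
    and "hconnected H"
    and "spectral_radius 3 H < 2 * root 3 4"
  shows "(\<exists>n\<ge>1. hisomorphic H (hypA n))
       \<or> (\<exists>n\<ge>3. hisomorphic H (hypD n))
       \<or> (\<exists>n\<ge>4. hisomorphic H (hypD' n))
       \<or> (\<exists>n\<ge>5. hisomorphic H (hypB n))
       \<or> (\<exists>n\<ge>6. hisomorphic H (hypB' n))
       \<or> (\<exists>n\<ge>7. hisomorphic H (hypBbar n))
       \<or> (\<exists>n\<ge>5. hisomorphic H (hypBD n))
       \<or> hisomorphic H hypE6 \<or> hisomorphic H hypE7 \<or> hisomorphic H hypE8
       \<or> hisomorphic H (hypF 2 3 3)
       \<or> (\<exists>k. 2 \<le> k \<and> k \<le> 6 \<and> hisomorphic H (hypF 2 2 k))
       \<or> (\<exists>k. 3 \<le> k \<and> k \<le> 13 \<and> hisomorphic H (hypF 1 3 k))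
       \<or> (\<exists>k. 4 \<le> k \<and> k \<le> 7 \<and> hisomorphic H (hypF 1 4 k))
       \<or> hisomorphic H (hypF 1 5 5)
       \<or> (\<exists>k\<le>5. hisomorphic H (hypG 1 1 k 1 3))"
proof -
  have sub: "subcritical (edges H) (verts H)"
    using assms(1,4) by (rule subcritical_if_spectral_radius_less)
  obtain e where e: "e \<in> edges H" using assms(2) by blast
  then have "e \<subseteq> verts H" "card e = 3" using assms(1) by (auto simp: uniform_hypergraph_def)
  then obtain v where "v \<in> verts H" by fastforce
  then obtain t where t: "hypertree (edges H) (verts H) v t"
    using subcritical_imp_hypertree[OF assms(1,3) sub] by blast
  have "good t" using t sub by (rule good_if_subcritical)
  moreover have "t \<noteq> Leaf" using t assms(2) by (auto elim: hypertree.cases)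
  ultimately obtain s where s: "unrooted_iso t s" "small_shape s" using good_imp_small_shape by blast
  have "realizes H s" using hypertree_unrooted_iso[OF s(1) t] by (auto simp: realizes_def)
  then have iso: "hisomorphic H K" if "realizes K s" for K :: "nat hypergraph"
    using realizes_isomorphic that by blast
  from s(2) show ?thesis
  proof cases
    case (A k)
    then have "hisomorphic H (hypA (Suc k))" using iso realizes_hypA by blast
    moreover have "Suc k \<ge> 1" by simp
    ultimately show ?thesis by blast
  next
    case (D k)
    \<comment> \<open>The shift makes the truncated subtraction genuine:
      \<open>k + 3 - 2 = Suc k\<close>. The other families are shifted for the same reason.\<close>
    have "hypD (k + 3) = hypE 1 1 (Suc k)" by (simp add: hypD_def)
    then have "hisomorphic H (hypD (k + 3))" using iso realizes_hypE D by metis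
    moreover have "k + 3 \<ge> 3" by simp
    ultimately show ?thesis by blast
  next
    case (E k)
    then have "hisomorphic H (hypE 1 2 k)" using iso realizes_hypE by blast
    then show ?thesis using E(2) unfolding hypE6_def hypE7_def hypE8_def by blast
  next
    case (BD k)
    then have "hisomorphic H (hypBD (k + 5))" using iso realizes_hypBD by blast
    moreover have "k + 5 \<ge> 5" by simp
    ultimately show ?thesis by blast
  next
    case (D' k)
    have "hypD' (k + 4) = hypF 1 1 (Suc k)" by (simp add: hypD'_def)
    then have "hisomorphic H (hypD' (k + 4))" using iso realizes_hypF D' by metis
    moreover have "k + 4 \<ge> 4" by simp
    ultimately show ?thesis by blast
  next
    case (B k)
    have "hypB (k + 5) = hypF 1 2 (Suc k)" by (simp add: hypB_def)
    then have "hisomorphic H (hypB (k + 5))" using iso realizes_hypF B by metis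
    moreover have "k + 5 \<ge> 5" by simp
    ultimately show ?thesis by blast
  next
    case (F13 k)
    then have "hisomorphic H (hypF 1 3 k)" using iso realizes_hypF by blast
    then show ?thesis using F13(2) unfolding atLeastAtMost_iff by blast
  next
    case (F14 k)
    then have "hisomorphic H (hypF 1 4 k)" using iso realizes_hypF by blast
    then show ?thesis using F14(2) unfolding atLeastAtMost_iff by blast
  next
    case F15
    then have "hisomorphic H (hypF 1 5 5)" using iso realizes_hypF by blast
    then show ?thesis by blast
  next
    case (F22 k)
    then have "hisomorphic H (hypF 2 2 k)" using iso realizes_hypF by blast
    then show ?thesis using F22(2) unfolding atLeastAtMost_iff by blast
  next
    case F23
    then have "hisomorphic H (hypF 2 3 3)" using iso realizes_hypF by blast
    then show ?thesis by blast
  next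
    case (G11 k)
    have "hypB' (k + 6) = hypG 1 1 k 1 1" by (simp add: hypB'_def)
    then have "hisomorphic H (hypB' (k + 6))" using iso realizes_hypG G11 by metis
    moreover have "k + 6 \<ge> 6" by simp
    ultimately show ?thesis by blast
  next
    case (G12 k)
    have "hypBbar (k + 7) = hypG 1 1 k 1 2" by (simp add: hypBbar_def)
    then have "hisomorphic H (hypBbar (k + 7))" using iso realizes_hypG G12 by metis
    moreover have "k + 7 \<ge> 7" by simp
    ultimately show ?thesis by blast
  next
    case (G13 k)
    then have "hisomorphic H (hypG 1 1 k 1 3)" using iso realizes_hypG by blast
    then show ?thesis using G13(2) by blast
  qed
qed

end
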